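(* There exists a transcendental entire function $f$ such that each of the sets $\widehat{I}(f) := I(f)\cup\{\infty\}$, $\widehat{BO}(f) := BO(f)\cup\{\infty\}$ and $\widehat{BU}(f) := BU(f)\cup\{\infty\}$ is a connected subset of the Riemann sphere $\widehat{\mathbb{C}}$.
   Context: For an entire function $f$, $f^n$ denotes its $n$-th iterate. The escaping set is $I(f) := \{z\in\mathbb{C} : f^n(z)\to\infty \text{ as } n\to\infty\}$. The bounded orbit set is $BO(f) := \{z\in\mathbb{C} : \text{there exists } K>0 \text{ such that } |f^n(z)|<K \text{ for all } n\ge 0\}$. The bungee set is $BU(f) := \mathbb{C}\setminus (I(f)\cup BO(f))$. *)

theory Defs
  imports "HOL-Complex_Analysis.Complex_Analysis" "HOL-Computational_Algebra.Polynomial"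
begin

definition transcendental_entire :: "(complex \<Rightarrow> complex) \<Rightarrow> bool" where
  "transcendental_entire f \<longleftrightarrow> f holomorphic_on UNIV \<and> \<not> (\<exists>p. \<forall>z. f z = poly p z)"

definition escaping_set :: "(complex \<Rightarrow> complex) \<Rightarrow> complex set" where
  "escaping_set f = {z. filterlim (\<lambda>n. (f ^^ n) z) at_infinity sequentially}"

definition bounded_orbit_set :: "(complex \<Rightarrow> complex) \<Rightarrow> complex set" where
  "bounded_orbit_set f = {z. \<exists>K>0. \<forall>n. norm ((f ^^ n) z) < K}"

definition bungee_set :: "(complex \<Rightarrow> complex) \<Rightarrow> complex set" where
  "bungee_set f = UNIV - (escaping_set f \<union> bounded_orbit_set f)"

text \<open>The Riemann sphere, realised as the unit sphere in R^3 via inverse stereographic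
  projection; None represents the point at infinity.\<close>
definition sphere_pt :: "complex option \<Rightarrow> real \<times> real \<times> real" where
  "sphere_pt w = (case w of
      None \<Rightarrow> (0, 0, 1)
    | Some z \<Rightarrow> (2 * Re z / (cmod z ^ 2 + 1), 2 * Im z / (cmod z ^ 2 + 1),
                 (cmod z ^ 2 - 1) / (cmod z ^ 2 + 1)))"

definition connected_with_infinity :: "complex set \<Rightarrow> bool" where
  "connected_with_infinity S \<longleftrightarrow> connected (sphere_pt ` (insert None (Some ` S)))"

end

theory Submission
  imports Defs
begin

text \<open>
  The function is \<open>f z = ln 2 * (exp z - 1)\<^sup>2\<close>. Its critical value \<open>0\<close> is a superattracting fixed
  point, and its finite asymptotic value \<open>ln 2\<close> is a repelling fixed point. Real points below
  \<open>ln 2\<close> have bounded orbits and real points above \<open>ln 2\<close> escape.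

  If \<open>S \<union> {\<infinity>}\<close> is disconnected, some bounded open set \<open>G\<close> meets \<open>S\<close> while its frontier does not,
  and the frontier of \<open>f\<^sup>n(G)\<close> lies in the image of the frontier of \<open>G\<close>. As \<open>f\<close> expands the hyperbolic
  metric of the half-planes (both singular values are real), some \<open>f\<^sup>n(G)\<close> meets the real line. If \<open>G\<close>
  contains a point with unbounded orbit, Montel's theorem improves this to meeting \<open>[ln 2, \<infinity>)\<close>, and
  near this ray \<open>f\<close> expands so much that the images eventually cover any given disc. Hence the
  frontier of some \<open>f\<^sup>n(G)\<close> meets the real line in points of \<open>I(f)\<close> and of \<open>BO(f)\<close>, respectively.

  For \<open>BU(f)\<close>, let \<open>H\<close> be a bounded open set containing a large disc. The part of its frontier in the
  left half-plane is mapped by \<open>f\<close> onto a set that still surrounds \<open>ln 2\<close> and stays in a fixed disc. The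
  domain around \<open>ln 2\<close> obtained in this way blows up again to one containing an arbitrarily large disc.
  Alternating these two steps gives nested compact subsets of the frontier of \<open>H\<close>, whose common points
  have orbits that are unbounded but return to a fixed disc infinitely often.
\<close>

section \<open>Topology of the Riemann sphere and of frontiers\<close>

text \<open>If the set together with infinity splits into two relatively open pieces, the piece
  without infinity is cut out by an open set of the plane. This set is bounded, since points near
  infinity belong to the other piece, and its frontier misses \<open>S\<close>.\<close>

lemma connected_with_infinityI:
  assumes "\<And>G. \<lbrakk>open G; bounded G; G \<inter> S \<noteq> {}; frontier G \<inter> S = {}\<rbrakk> \<Longrightarrow> False"
  shows "connected_with_infinity S"
  unfolding connected_with_infinity_def
proof (rule ccontr)
  define N where "N = sphere_pt None"
  define X where "X = sphere_pt ` insert None (Some ` S)"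
  assume "\<not> connected (sphere_pt ` insert None (Some ` S))"
  then obtain A' B' where AB': "open A'" "open B'" "A' \<inter> X \<noteq> {}" "B' \<inter> X \<noteq> {}"
      "A' \<inter> B' \<inter> X = {}" "X \<subseteq> A' \<union> B'"
    unfolding connected_def X_def[symmetric] by metis
  have "N \<in> X" by (simp add: X_def N_def)
  have "\<exists>A B. open A \<and> open B \<and> A \<inter> X \<noteq> {} \<and> B \<inter> X \<noteq> {} \<and> A \<inter> B \<inter> X = {} \<and> X \<subseteq> A \<union> B \<and> N \<in> B"
  proof (cases "N \<in> B'")
    case True
    with AB' show ?thesis by metis
  next
    case False
    with AB' \<open>N \<in> X\<close> have "N \<in> A'" by auto
    with AB' show ?thesis by (metis Int_commute Un_commute)
  qed
  then obtain A B where AB: "open A" "open B" "A \<inter> X \<noteq> {}" "B \<inter> X \<noteq> {}"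
      "A \<inter> B \<inter> X = {}" "X \<subseteq> A \<union> B" "N \<in> B"
    by metis
  \<comment> \<open>\<open>A\<close> and \<open>B\<close> are disjoint only within \<open>X\<close>.
    They are replaced by open sets \<open>C\<close> and \<open>D\<close> that are disjoint
    everywhere, so that the preimage of \<open>D\<close> stays away from the closure of
    \<open>G\<close>.\<close>
  have "A \<inter> (X \<inter> B) = {}" "B \<inter> (X \<inter> A) = {}"
    using AB(5) by blast+
  then have "A \<inter> closure (X \<inter> B) = {}" "B \<inter> closure (X \<inter> A) = {}"
    using AB(1,2) by (simp_all add: open_Int_closure_eq_empty)
  then have "X \<inter> A \<inter> closure (X \<inter> B) = {}" "X \<inter> B \<inter> closure (X \<inter> A) = {}"
    by blast+
  then obtain C D where CD: "C \<inter> D = {}" "open C" "open D" "X \<inter> A \<subseteq> C" "X \<inter> B \<subseteq> D"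
    by (rule separation_closures) (simp_all add: Int_commute)
  define p where "p = (\<lambda>z. sphere_pt (Some z))"
  have p_cont: "continuous_on UNIV p"
  proof -
    have "cmod z ^ 2 + 1 \<noteq> 0" for z
      by (smt (verit) zero_le_power2)
    then show ?thesis
      unfolding p_def sphere_pt_def option.case by (intro continuous_intros ballI)
  qed
  define G where "G = p -` C"
  have "open G" "open (p -` D)"
    unfolding G_def using p_cont CD by (auto intro!: open_vimage)
  have "(p \<longlongrightarrow> N) at_infinity"
  proof -
    have n: "filterlim (cmod :: complex \<Rightarrow> real) at_top at_infinity"
      by (rule filterlim_norm_at_top)
    have k: "\<bar>2 * c / (r\<^sup>2 + 1)\<bar> \<le> 2 / r" if "\<bar>c\<bar> \<le> r" "r > 0" for c r :: real
    proof -
      have "\<bar>c\<bar> * r \<le> r * r"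
        using that by (intro mult_right_mono) auto
      then have "\<bar>c\<bar> * r \<le> r\<^sup>2 + 1"
        by (simp add: power2_eq_square)
      then show ?thesis
        using that by (simp add: abs_mult field_simps add_pos_nonneg)
    qed
    have l: "((\<lambda>z::complex. 2 / cmod z) \<longlongrightarrow> 0) at_infinity"
      by (intro tendsto_divide_0[OF tendsto_const] filterlim_at_top_imp_at_infinity n)
    have ev: "eventually (\<lambda>z::complex. cmod z > 0) at_infinity"
      using filterlim_at_top_dense[THEN iffD1, OF n] by blast
    have 1: "((\<lambda>z. 2 * Re z / (cmod z ^ 2 + 1)) \<longlongrightarrow> 0) at_infinity"
      by (rule Lim_null_comparison[OF _ l]) 
        (rule eventually_mono[OF ev], unfold real_norm_def, rule k[OF abs_Re_le_cmod])
    have 2: "((\<lambda>z. 2 * Im z / (cmod z ^ 2 + 1)) \<longlongrightarrow> 0) at_infinity"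
      by (rule Lim_null_comparison[OF _ l]) 
        (rule eventually_mono[OF ev], unfold real_norm_def, rule k[OF abs_Im_le_cmod])
    have "((\<lambda>r::real. (r ^ 2 - 1) / (r ^ 2 + 1)) \<longlongrightarrow> 1) at_top"
      by real_asymp
    then have 3: "((\<lambda>z::complex. (cmod z ^ 2 - 1) / (cmod z ^ 2 + 1)) \<longlongrightarrow> 1) at_infinity"
      using filterlim_compose n by blast
    show ?thesis
      unfolding p_def N_def sphere_pt_def option.case by (intro tendsto_Pair 1 2 3)
  qed
  moreover have "N \<in> D"
    using AB(7) CD(5) \<open>N \<in> X\<close> by blast
  ultimately have "eventually (\<lambda>z. p z \<in> D) at_infinity"
    using CD(3) by (auto simp: tendsto_def)
  then obtain R where R: "\<And>z. R \<le> cmod z \<Longrightarrow> p z \<in> D"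
    by (auto simp: eventually_at_infinity)
  have "bounded G"
    unfolding bounded_iff
  proof (intro exI ballI)
    fix z assume "z \<in> G"
    then show "cmod z \<le> R" using R[of z] CD(1) by (force simp: G_def)
  qed
  moreover have "G \<inter> S \<noteq> {}"
  proof -
    obtain x where "x \<in> A" "x \<in> X" using AB by blast
    moreover have "x \<noteq> N" using AB \<open>x \<in> A\<close> \<open>x \<in> X\<close> by blast
    ultimately obtain s where "s \<in> S" "x = p s" by (auto simp: X_def N_def p_def)
    then show ?thesis using CD(4) \<open>x \<in> A\<close> \<open>x \<in> X\<close> by (auto simp: G_def)
  qed
  moreover have "frontier G \<inter> S = {}"
  proof -
    have False if "s \<in> frontier G" "s \<in> S" for s
    proof -
      have "s \<notin> G" using that \<open>open G\<close> by (simp add: frontier_def interior_open)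
      then have "p s \<notin> C" by (simp add: G_def)
      moreover have "p s \<in> X" using that by (simp add: X_def p_def)
      ultimately have "p s \<in> D" using CD(4,5) AB(6) by blast
      moreover have "p -` D \<inter> closure G = {}"
        using CD(1) unfolding G_def open_Int_closure_eq_empty[OF \<open>open (p -` D)\<close>] by blast
      ultimately show False using that by (auto simp: frontier_def)
    qed
    then show ?thesis by blast
  qed
  ultimately show False using assms \<open>open G\<close> by blast
qed

text \<open>The image of the compact set \<open>closure G\<close> is closed, so it contains the
  closure of \<open>f\<close> G\<open>; a limit point outside the open set\<close>f \<open>G\<close>
  can only come from the frontier.\<close>

lemma frontier_image_subset:
  fixes f :: "'a::euclidean_space \<Rightarrow> 'b::t2_space"
  assumes "continuous_on UNIV f" "bounded G" "open (f ` G)"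
  shows "frontier (f ` G) \<subseteq> f ` frontier G"
proof -
  have "compact (f ` closure G)"
    using assms by (intro compact_continuous_image) (auto intro: continuous_on_subset)
  then have "closure (f ` G) \<subseteq> f ` closure G"
    by (intro closure_minimal compact_imp_closed) (auto simp: closure_subset image_mono)
  moreover have "x \<in> f ` (closure G - interior G)" if "x \<in> f ` closure G" "x \<notin> f ` G" for x
    using that interior_subset[of G] by auto
  ultimately show ?thesis
    using assms(3) by (auto simp: frontier_def interior_open)
qed

section \<open>Square roots and maps into half-planes\<close>

lemma Re_csqrt_pos:
  assumes "z \<notin> \<real>\<^sub>\<le>\<^sub>0"
  shows "Re (csqrt z) > 0"
proof -
  have "s\<^sup>2 \<in> \<real>\<^sub>\<le>\<^sub>0" if "Re s = 0" for s :: complex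
    using that by (simp add: complex_nonpos_Reals_iff Re_power2 Im_power2)
  then have "Re (csqrt z) \<noteq> 0"
    using assms by (metis power2_csqrt)
  then show ?thesis using Re_csqrt[of z] by linarith
qed

text \<open>The Cayley transform at \<open>g z\<close> turns \<open>g\<close> into a map to the unit disc.\<close>
lemma deriv_bound_avoiding_real_line:
  assumes g: "g holomorphic_on ball z r" and r: "r > 0"
    and avoid: "\<And>w. w \<in> ball z r \<Longrightarrow> Im (g w) \<noteq> 0"
  shows "cmod (deriv g z) \<le> 4 * \<bar>Im (g z)\<bar> / r"
proof -
  define c where "c = g z"
  have conn: "connected ((\<lambda>w. Im (g w)) ` ball z r)"
    by (intro connected_continuous_image continuous_intros holomorphic_on_imp_continuous_on g) auto
  \<comment> \<open>By connectedness \<open>g\<close> stays in the half-plane of \<open>c\<close>,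
    where each point is closer to \<open>c\<close> than to \<open>cnj c\<close>.\<close>
  have same: "Im (g w) * Im c > 0" if w: "w \<in> ball z r" for w
  proof (rule ccontr)
    assume "\<not> Im (g w) * Im c > 0"
    then have "Im (g w) \<le> 0 \<and> 0 \<le> Im c \<or> Im c \<le> 0 \<and> 0 \<le> Im (g w)"
      by (smt (verit) mult_pos_pos mult_neg_neg)
    then have "0 \<in> (\<lambda>w. Im (g w)) ` ball z r"
      using connectedD_interval[OF conn] w r by (metis c_def centre_in_ball image_eqI)
    then show False using avoid by auto
  qed
  have less: "cmod (g w - c) < cmod (g w - cnj c)" if w: "w \<in> ball z r" for w
  proof -
    have "(cmod (g w - c))\<^sup>2 < (cmod (g w - cnj c))\<^sup>2"
      using same[OF w] by (simp add: cmod_power2) (simp add: power2_eq_square algebra_simps)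
    then show ?thesis by (simp add: power_less_imp_less_base)
  qed
  have nz: "g w - cnj c \<noteq> 0" if w: "w \<in> ball z r" for w
    using less[OF w] by auto
  define h where "h = (\<lambda>w. (g w - c) / (g w - cnj c))"
  have h: "h holomorphic_on ball z r"
    unfolding h_def using nz by (intro holomorphic_intros g) auto
  have sub: "cball z (r/2) \<subseteq> ball z r" "ball z (r/2) \<subseteq> ball z r" using r by (auto simp: subset_iff)
  \<comment> \<open>The Cauchy estimate needs continuity up to the boundary, so it is applied on
    half the radius. This costs a factor 2; the other factor 2 of the final bound comes from
    \<open>c - cnj c\<close>.\<close>
  have "cmod ((deriv ^^ 1) h z) \<le> fact 1 * 1 / (r/2) ^ 1"
  proof (rule Cauchy_higher_deriv_bound)
    show "h holomorphic_on ball z (r/2)" using h sub(2) by (rule holomorphic_on_subset)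
    show "continuous_on (cball z (r/2)) h"
      using h sub by (meson holomorphic_on_imp_continuous_on holomorphic_on_subset)
    show "h w \<in> ball 0 1" if "w \<in> ball z (r/2)" for w
      using less[of w] nz[of w] that sub by (auto simp: h_def norm_divide divide_less_eq)
  qed (use r in auto)
  then have hb: "cmod (deriv h z) \<le> 2 / r" by simp
  have zb: "z \<in> ball z r" using r by simp
  have "(g has_field_derivative deriv g z) (at z)"
    using g zb by (meson holomorphic_derivI open_ball)
  then have "(h has_field_derivative deriv g z / (c - cnj c)) (at z)"
    unfolding h_def using nz[OF zb]
    by (rule_tac DERIV_cong[OF DERIV_divide[OF DERIV_diff[OF _ DERIV_const] DERIV_diff[OF _ DERIV_const]]])
      (auto simp: c_def)
  then have "deriv h z = deriv g z / (c - cnj c)" by (rule DERIV_imp_deriv)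
  moreover have "cmod (c - cnj c) = 2 * \<bar>Im c\<bar>"
    by (simp add: complex_diff_cnj norm_mult)
  moreover have "Im c \<noteq> 0" using avoid[OF zb] by (simp add: c_def)
  ultimately show ?thesis
    using hb r by (simp add: norm_divide c_def field_simps)
qed

section \<open>The function and its iterates\<close>

text \<open>The factor \<open>ln 2\<close> is the limit as \<open>Re z\<close> tends to minus
  infinity, and \<open>exp (ln 2) - 1 = 1\<close> makes this value a fixed point. The square makes
  the zero at \<open>0\<close> a critical point.\<close>

definition sqexp :: "complex \<Rightarrow> complex" where
  "sqexp z = of_real (ln 2) * (exp z - 1)\<^sup>2"

definition sqexp_real :: "real \<Rightarrow> real" where
  "sqexp_real x = ln 2 * (exp x - 1)\<^sup>2"

lemma sqexp_of_real: "sqexp (of_real x) = of_real (sqexp_real x)"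
  by (simp add: sqexp_def sqexp_real_def exp_of_real)

lemma sqexp_iterate_of_real: "(sqexp ^^ n) (of_real x) = of_real ((sqexp_real ^^ n) x)"
  by (induction n) (simp_all add: sqexp_of_real)

lemma holomorphic_sqexp: "sqexp holomorphic_on S"
  unfolding sqexp_def by (intro holomorphic_intros)

lemma holomorphic_sqexp_iterate: "(sqexp ^^ n) holomorphic_on S"
proof (induction n)
  case (Suc n)
  then have "(sqexp \<circ> (sqexp ^^ n)) holomorphic_on S"
    by (intro holomorphic_on_compose holomorphic_sqexp)
  then show ?case by (simp add: o_def)
qed (simp add: id_def)

lemma continuous_sqexp_iterate: "continuous_on S (sqexp ^^ n)"
  by (intro holomorphic_on_imp_continuous_on holomorphic_sqexp_iterate)

lemma open_sqexp_image:
  assumes "open U"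
  shows "open (sqexp ` U)"
proof (rule open_mapping_thm[of sqexp UNIV])
  have "sqexp 0 \<noteq> sqexp 1"
    using sqexp_of_real[of 1] by (simp add: sqexp_def sqexp_real_def)
  then show "\<not> sqexp constant_on UNIV"
    unfolding constant_on_def by (metis UNIV_I)
qed (use assms holomorphic_sqexp in auto)

lemma open_sqexp_iterate_image: "open U \<Longrightarrow> open ((sqexp ^^ n) ` U)"
  by (induction n) (simp_all add: open_sqexp_image image_comp[symmetric] del: image_comp o_apply)

lemma bounded_sqexp_iterate_image:
  assumes "bounded U"
  shows "bounded ((sqexp ^^ n) ` U)"
proof -
  have "compact ((sqexp ^^ n) ` closure U)"
    using assms by (intro compact_continuous_image continuous_sqexp_iterate) auto
  then show ?thesis
    by (meson bounded_subset closure_subset compact_imp_bounded image_mono)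
qed

lemma frontier_sqexp_iterate_image:
  assumes "open U" "bounded U"
  shows "frontier ((sqexp ^^ n) ` U) \<subseteq> (sqexp ^^ n) ` frontier U"
  using assms by (intro frontier_image_subset continuous_sqexp_iterate open_sqexp_iterate_image)

text \<open>A nonzero polynomial has finitely many zeros, whereas \<open>sqexp\<close> vanishes at
  all integer multiples of \<open>2 * pi * \<i>\<close>.\<close>

lemma sqexp_transcendental: "transcendental_entire sqexp"
  unfolding transcendental_entire_def
proof (intro conjI notI)
  assume "\<exists>p. \<forall>z. sqexp z = poly p z"
  then obtain p where p: "\<And>z. sqexp z = poly p z" by blast
  define a where "a = (\<lambda>k::nat. 2 * of_real pi * \<i> * of_nat k)"
  have "inj a" by (auto simp: a_def inj_on_def)
  moreover have "range a \<subseteq> {z. poly p z = 0}"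
  proof safe
    fix k
    have "exp (a k) = 1"
      unfolding a_def exp_eq_1 by (auto intro!: exI[of _ "int k"])
    then show "poly p (a k) = 0"
      by (simp add: p[symmetric] sqexp_def)
  qed
  ultimately have "infinite {z. poly p z = 0}"
    using range_inj_infinite finite_subset by blast
  then have "p = 0" using poly_roots_finite by blast
  then have "sqexp 1 = 0" using p by simp
  then show False using sqexp_of_real[of 1] by (simp add: sqexp_real_def)
qed (rule holomorphic_sqexp)

lemma sqexp_iterate_add: "(sqexp ^^ (m + n)) z = (sqexp ^^ m) ((sqexp ^^ n) z)"
  by (simp add: funpow_add)

lemma escaping_set_iterate:
  assumes "(f ^^ n) z \<in> escaping_set f"
  shows "z \<in> escaping_set f"
proof -
  have "filterlim (\<lambda>k. (f ^^ (k + n)) z) at_infinity sequentially"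
    using assms by (simp add: escaping_set_def funpow_add)
  then show ?thesis
    unfolding escaping_set_def mem_Collect_eq filterlim_iff
    using eventually_sequentially_seg[of "\<lambda>k. P ((f ^^ k) z)" n for P] by blast
qed

text \<open>The finitely many earlier iterates are absorbed into a maximum; adding 1 makes the bound
  strict and positive.\<close>

lemma bounded_orbit_setI:
  assumes "\<And>k. norm ((f ^^ (k + n)) z) \<le> B"
  shows "z \<in> bounded_orbit_set f"
proof -
  define K where "K = Max (insert B ((\<lambda>k. norm ((f ^^ k) z)) ` {..n}))"
  have "norm ((f ^^ k) z) \<le> K" for k
  proof (cases "k \<le> n")
    case True
    then show ?thesis unfolding K_def by (intro Max_ge) auto
  next
    case False
    then have "norm ((f ^^ k) z) \<le> B"
      using assms[of "k - n"] by simp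
    also have "B \<le> K" unfolding K_def by (intro Max_ge) auto
    finally show ?thesis .
  qed
  moreover have "0 \<le> K" using calculation[of 0] norm_ge_zero order_trans by blast
  ultimately have "0 < K + 1 \<and> (\<forall>k. norm ((f ^^ k) z) < K + 1)"
    by (smt (verit))
  then show ?thesis unfolding bounded_orbit_set_def by blast
qed

lemma bounded_orbit_set_iterate:
  assumes "(f ^^ n) z \<in> bounded_orbit_set f"
  shows "z \<in> bounded_orbit_set f"
proof -
  obtain K where "\<And>k. norm ((f ^^ k) ((f ^^ n) z)) < K"
    using assms by (auto simp: bounded_orbit_set_def)
  then show ?thesis
    by (intro bounded_orbit_setI[where n = n and B = K]) (simp add: funpow_add less_imp_le)
qed

section \<open>Dynamics on the real line\<close>

lemma sqexp_real_nonneg: "0 \<le> sqexp_real x"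
  by (simp add: sqexp_real_def)

lemma sqexp_real_below:
  assumes "x < ln 2"
  shows "sqexp_real x < ln 2"
proof -
  have "exp x < 2"
    using assms by (metis exp_less_cancel_iff exp_ln zero_less_numeral)
  then have "\<bar>exp x - 1\<bar> < 1" using exp_gt_zero[of x] by linarith
  then have "(exp x - 1)\<^sup>2 < 1" by (simp add: abs_square_less_1)
  then show ?thesis by (simp add: sqexp_real_def)
qed

text \<open>The chord bound for the convex function \<open>exp\<close> on \<open>[0, ln 2]\<close>.\<close>
lemma sqexp_real_le_square:
  assumes "0 \<le> x" "x \<le> ln 2"
  shows "sqexp_real x \<le> x\<^sup>2 / ln 2"
proof -
  define t where "t = x / ln 2"
  have t: "0 \<le> t" "t \<le> 1" "x = (1 - t) * 0 + t * ln 2"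
    using assms by (simp_all add: t_def)
  have "exp ((1 - t) *\<^sub>R 0 + t *\<^sub>R ln 2) \<le> (1 - t) * exp 0 + t * exp (ln (2::real))"
    using t by (intro convex_onD[OF exp_convex]) auto
  then have "exp x \<le> 1 + t" using t(3) by simp
  then have "(exp x - 1)\<^sup>2 \<le> t\<^sup>2"
    using assms by (intro power_mono) auto
  then have "sqexp_real x \<le> ln 2 * t\<^sup>2"
    by (simp add: sqexp_real_def)
  also have "\<dots> = x\<^sup>2 / ln 2" by (simp add: t_def power2_eq_square)
  finally show ?thesis .
qed

lemma sqexp_real_iterate_below:
  assumes "x < ln 2"
  shows "(sqexp_real ^^ n) x < ln 2"
  by (induction n) (simp_all add: assms sqexp_real_below)

lemma real_below_bounded_orbit:
  assumes "x < ln 2"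
  shows "of_real x \<in> bounded_orbit_set sqexp"
proof (rule bounded_orbit_setI)
  fix k
  \<comment> \<open>The starting point is skipped, as it may be very negative; all later iterates
    lie between \<open>0\<close> and \<open>ln 2\<close>.\<close>
  show "norm ((sqexp ^^ (k + 1)) (of_real x)) \<le> ln 2"
    using sqexp_real_iterate_below[OF assms, of "k + 1"] sqexp_real_nonneg[of "(sqexp_real ^^ k) x"]
    by (simp only: sqexp_iterate_of_real norm_of_real) simp
qed

text \<open>After one step the orbit lies in \<open>[0, ln 2)\<close>, where the chord bound
  multiplies \<open>u n\<close> by at most \<open>u n / ln 2\<close>. This ratio never exceeds its
  first value \<open>q < 1\<close>, so the decay is geometric.\<close>

lemma real_below_tendsto_0:
  assumes "x < ln 2"
  shows "(\<lambda>n. (sqexp ^^ n) (of_real x)) \<longlonglongrightarrow> 0"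
proof -
  define u where "u = (\<lambda>n. (sqexp_real ^^ (n + 1)) x)"
  have u0: "0 \<le> u n" for n
    by (simp add: u_def sqexp_real_nonneg)
  have ub: "u n < ln 2" for n
    unfolding u_def by (rule sqexp_real_iterate_below[OF assms])
  define q where "q = u 0 / ln 2"
  have q: "0 \<le> q" "q < 1" using u0 ub[of 0] by (simp_all add: q_def)
  have "u n \<le> u 0 * q ^ n \<and> u n \<le> u 0" for n
  proof (induction n)
    case (Suc n)
    have "u (Suc n) = sqexp_real (u n)" by (simp add: u_def)
    also have "\<dots> \<le> (u n)\<^sup>2 / ln 2" using u0 less_imp_le[OF ub] by (rule sqexp_real_le_square)
    also have "\<dots> = u n * (u n / ln 2)" by (simp add: power2_eq_square)
    also have "\<dots> \<le> u n * q"
      using Suc u0 by (intro mult_left_mono) (auto simp: q_def divide_right_mono)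
    finally have *: "u (Suc n) \<le> u n * q" .
    have "u n * q \<le> u 0 * q ^ Suc n"
      using Suc mult_right_mono[of "u n" "u 0 * q ^ n" q] q by (simp add: mult_ac)
    moreover have "u n * q \<le> u n" using q u0[of n] by (simp add: mult_left_le)
    ultimately show ?case using * Suc by linarith
  qed simp
  moreover have "(\<lambda>n. u 0 * q ^ n) \<longlonglongrightarrow> 0"
    using q by (auto intro!: tendsto_eq_intros)
  ultimately have "u \<longlonglongrightarrow> 0"
    using u0 by (intro tendsto_sandwich[of "\<lambda>_. 0" u _ "\<lambda>n. u 0 * q ^ n"]) auto
  then have "(\<lambda>n. (sqexp_real ^^ n) x) \<longlonglongrightarrow> 0"
    unfolding u_def by (rule LIMSEQ_offset)
  then show ?thesis
    using tendsto_of_real[of "\<lambda>n. (sqexp_real ^^ n) x" 0] by (simp add: sqexp_iterate_of_real)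
qed

text \<open>The derivative at the fixed point \<open>ln 2\<close> is \<open>4 * ln 2 > 2\<close>.
  The tangent bound for \<open>exp\<close> extends this to the whole ray, so the distance to
  \<open>ln 2\<close> at least doubles.\<close>

lemma sqexp_real_above:
  assumes "ln 2 \<le> x"
  shows "2 * (x - ln 2) \<le> sqexp_real x - ln 2"
proof -
  define d where "d = x - ln 2"
  have d: "0 \<le> d" using assms by (simp add: d_def)
  have "exp x = 2 * exp d" by (simp add: d_def exp_diff)
  then have "1 + 2 * d \<le> exp x - 1" using exp_ge_add_one_self[of d] by linarith
  then have "(1 + 2 * d)\<^sup>2 \<le> (exp x - 1)\<^sup>2" using d by (intro power_mono) auto
  moreover have "1 + 4 * d \<le> (1 + 2 * d)\<^sup>2" by (simp add: power2_eq_square algebra_simps)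
  ultimately have "ln 2 * (1 + 4 * d) \<le> sqexp_real x"
    by (simp add: sqexp_real_def)
  moreover have "1/2 * (4 * d) \<le> ln 2 * (4 * d)"
    using d ln2_ge_two_thirds by (intro mult_right_mono) auto
  ultimately show ?thesis by (simp add: d_def[symmetric] algebra_simps)
qed

lemma real_above_at_top:
  assumes "ln 2 < x"
  shows "filterlim (\<lambda>n. (sqexp_real ^^ n) x) at_top sequentially"
proof -
  have lower: "(x - ln 2) * 2 ^ n \<le> (sqexp_real ^^ n) x - ln 2" for n
  proof (induction n)
    case (Suc n)
    have "ln 2 \<le> (sqexp_real ^^ n) x"
      using Suc assms by (smt (verit) mult_nonneg_nonneg zero_le_power)
    from sqexp_real_above[OF this] show ?case using Suc by simp
  qed simp
  have "filterlim (\<lambda>n. (x - ln 2) * 2 ^ n) at_top sequentially"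
    using assms by real_asymp
  then show ?thesis
    by (rule filterlim_at_top_mono) (use lower in \<open>auto intro!: always_eventually\<close>, smt (verit) ln_gt_zero)
qed

lemma real_above_escaping:
  assumes "ln 2 < x"
  shows "of_real x \<in> escaping_set sqexp"
proof -
  have "filterlim (\<lambda>n. norm ((sqexp ^^ n) (of_real x))) at_top sequentially"
    by (rule filterlim_at_top_mono[OF real_above_at_top[OF assms]])
       (auto simp: sqexp_iterate_of_real intro!: always_eventually)
  then show ?thesis
    by (simp add: escaping_set_def filterlim_at_infinity_conv_norm_at_top)
qed

section \<open>The basin of the superattracting fixed point\<close>

lemma norm_exp_minus_1_le:
  fixes z :: complex
  assumes "norm z \<le> 1/2"
  shows "norm (exp z - 1) \<le> 2 * norm z"
proof -
  have "norm (exp z - exp 0) \<le> 2 * norm (z - 0)"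
  proof (rule field_differentiable_bound[of "cball 0 (1/2)" exp exp])
    show "cmod (exp w) \<le> 2" if "w \<in> cball 0 (1/2)" for w
      using that by (intro exp_bound_half) simp
  qed (use assms in \<open>auto intro!: derivative_eq_intros\<close>)
  then show ?thesis by simp
qed

text \<open>The bound on \<open>exp z - 1\<close> gives
  \<open>norm (sqexp z) \<le> 3 * (norm z)\<^sup>2\<close>, and the radius \<open>1/6\<close> turns
  one factor into \<open>1/2\<close>.\<close>

lemma sqexp_near_0:
  assumes "norm z < 1/6"
  shows "norm (sqexp z) \<le> norm z / 2"
proof -
  have "norm (exp z - 1) \<le> 2 * norm z"
    using assms by (intro norm_exp_minus_1_le) simp
  then have "(norm (exp z - 1))\<^sup>2 \<le> (2 * norm z)\<^sup>2" by (intro power_mono) auto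
  then have "norm (sqexp z) \<le> ln 2 * (2 * norm z)\<^sup>2"
    by (simp add: sqexp_def norm_mult norm_power)
  also have "\<dots> \<le> 3/4 * (2 * norm z)\<^sup>2" using ln2_le_25_over_36 by (intro mult_right_mono) auto
  also have "\<dots> = 3 * norm z * norm z" by (simp add: power2_eq_square)
  also have "\<dots> \<le> 1/2 * norm z" using assms by (intro mult_right_mono) auto
  finally show ?thesis by simp
qed

lemma sqexp_iterate_near_0:
  assumes "norm z < 1/6"
  shows "norm ((sqexp ^^ n) z) \<le> norm z * (1/2) ^ n"
proof (induction n)
  case (Suc n)
  have "norm z * (1/2) ^ n \<le> norm z" by (simp add: mult_left_le power_le_one)
  then have "norm ((sqexp ^^ n) z) < 1/6" using Suc assms by linarith
  from sqexp_near_0[OF this] show ?case using Suc by simp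
qed simp

lemma sqexp_iterate_near_0_tendsto:
  assumes "norm ((sqexp ^^ m) z) < 1/6"
  shows "(\<lambda>n. (sqexp ^^ n) z) \<longlonglongrightarrow> 0"
proof -
  have "(\<lambda>n. norm ((sqexp ^^ m) z) * (1/2) ^ n) \<longlonglongrightarrow> 0"
    by (intro tendsto_mult_right_zero LIMSEQ_power_zero) auto
  then have "(\<lambda>n. (sqexp ^^ n) ((sqexp ^^ m) z)) \<longlonglongrightarrow> 0"
    by (rule Lim_null_comparison[rotated]) (use sqexp_iterate_near_0[OF assms] in \<open>auto intro!: always_eventually\<close>)
  then have "(\<lambda>n. (sqexp ^^ (n + m)) z) \<longlonglongrightarrow> 0"
    by (simp add: sqexp_iterate_add)
  then show ?thesis by (rule LIMSEQ_offset)
qed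

lemma sqexp_iterate_near_0_bounded_orbit:
  assumes "norm ((sqexp ^^ m) z) < 1/6"
  shows "z \<in> bounded_orbit_set sqexp"
proof (rule bounded_orbit_setI)
  fix k
  have "norm ((sqexp ^^ (k + m)) z) \<le> norm ((sqexp ^^ m) z) * (1/2) ^ k"
    using sqexp_iterate_near_0[OF assms] by (simp add: sqexp_iterate_add)
  also have "\<dots> \<le> norm ((sqexp ^^ m) z)" by (simp add: mult_left_le power_le_one)
  finally show "norm ((sqexp ^^ (k + m)) z) \<le> 1/6" using assms by simp
qed

section \<open>Hyperbolic expansion: iterates reach the real line and the ray\<close>

lemma sqexp_has_derivative:
  "(sqexp has_field_derivative of_real (2 * ln 2) * (exp z - 1) * exp z) (at z)"
  unfolding sqexp_def by (auto intro!: derivative_eq_intros simp: field_simps)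

lemma Re_sqexp: "Re (sqexp z) = ln 2 * ((Re (exp z) - 1)\<^sup>2 - (Im (exp z))\<^sup>2)"
  by (simp add: sqexp_def Re_power2 del: Re_exp Im_exp)

lemma Im_sqexp: "Im (sqexp z) = 2 * ln 2 * (Re (exp z) - 1) * Im (exp z)"
  by (simp add: sqexp_def Im_power2 del: Re_exp Im_exp)

text \<open>Both factors in the last bracket are at least \<open>1\<close>, so the map expands the hyperbolic metric
  \<open>|dz| / |Im z|\<close> of the half-planes.\<close>
lemma sqexp_hyperbolic_expansion:
  assumes "Im (sqexp z) \<noteq> 0"
  shows "cmod (of_real (2 * ln 2) * (exp z - 1) * exp z) * \<bar>Im z\<bar> =
    \<bar>Im (sqexp z)\<bar> * (cmod (exp z - 1) / \<bar>Re (exp z) - 1\<bar> * (\<bar>Im z\<bar> / \<bar>sin (Im z)\<bar>))"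
proof -
  have ne: "Re (exp z) - 1 \<noteq> 0" "Im (exp z) \<noteq> 0" using assms by (auto simp: Im_sqexp)
  have im: "\<bar>Im (exp z)\<bar> = cmod (exp z) * \<bar>sin (Im z)\<bar>"
    by (simp add: Im_exp abs_mult)
  then have "sin (Im z) \<noteq> 0" using ne by auto
  moreover have "\<bar>Im (sqexp z)\<bar> = 2 * ln 2 * \<bar>Re (exp z) - 1\<bar> * (cmod (exp z) * \<bar>sin (Im z)\<bar>)"
    unfolding im[symmetric] by (simp add: Im_sqexp abs_mult del: Re_exp Im_exp)
  moreover have "cmod (of_real (2 * ln 2) * (exp z - 1) * exp z) = 2 * ln 2 * cmod (exp z - 1) * cmod (exp z)"
    by (simp add: norm_mult del: norm_exp_eq_Re)
  ultimately show ?thesis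
    using ne by (simp add: field_simps del: norm_exp_eq_Re Re_exp Im_exp)
qed

text \<open>\<open>t\<close> is the tangent of the angle at which \<open>exp z\<close> is seen from \<open>1\<close>; squaring doubles this angle.\<close>
lemma sqexp_angle_expansion:
  fixes t :: "complex \<Rightarrow> real"
  defines "t \<equiv> \<lambda>z. \<bar>Im (exp z)\<bar> / \<bar>Re (exp z) - 1\<bar>"
  assumes w: "w = sqexp z" and ne: "Im (exp z) \<noteq> 0" "Re (exp z) \<noteq> 1" "Re (exp w) \<noteq> 1"
    and t: "t z < 1/2" "t w < 1" and sin: "\<bar>Im w\<bar> \<le> 11/10 * \<bar>sin (Im w)\<bar>"
  shows "3/2 * t z \<le> t w"
proof -
  define a v where "a = \<bar>Re (exp z) - 1\<bar>" and "v = \<bar>Im (exp z)\<bar>"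
  have av: "a > 0" "v > 0" "t z = v / a" using ne by (auto simp: a_def v_def t_def)
  then have "v / a < 1 / 2" using t(1) by simp
  then have "2 * v < a" using \<open>a > 0\<close> by (simp add: field_simps)
  then have "v\<^sup>2 < a\<^sup>2" using av by (intro power_strict_mono) auto
  define x y where "x = Re w" and "y = \<bar>Im w\<bar>"
  have x: "x = ln 2 * (a\<^sup>2 - v\<^sup>2)" by (simp add: x_def w Re_sqexp a_def v_def del: Re_exp Im_exp)
  then have "x > 0" using \<open>v\<^sup>2 < a\<^sup>2\<close> by simp
  have y: "y = 2 * ln 2 * a * v" by (simp add: y_def w Im_sqexp a_def v_def abs_mult del: Re_exp Im_exp)
  have "x \<le> ln 2 * a\<^sup>2" by (simp add: x)
  then have "2 * v * x \<le> 2 * v * (ln 2 * a\<^sup>2)" using av by (intro mult_left_mono) auto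
  also have "\<dots> = y * a" by (simp add: y power2_eq_square)
  \<comment> \<open>\<open>y / x\<close> is the tangent of the doubled angle;
    \<open>t z < 1/2\<close> keeps that angle acute.\<close>
  finally have quot: "2 * t z \<le> y / x"
    unfolding av(3) using av(1,2) \<open>x > 0\<close> by (simp add: field_simps)
  define s c where "s = \<bar>sin (Im w)\<bar>" and "c = cos (Im w)"
  have s: "y \<le> 11/10 * s" "s \<le> 1" using sin by (auto simp: y_def s_def)
  have "y > 0" using av by (simp add: y)
  then have "s > 0" using s by linarith
  have "c > 0"
  proof -
    have "\<bar>Im w\<bar> < pi / 2" using s pi_gt3 by (simp add: y_def)
    then show ?thesis unfolding c_def by (intro cos_gt_zero_pi) auto
  qed
  have sc: "s\<^sup>2 = (1 - c) * (1 + c)"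
    using sin_cos_squared_add[of "Im w"] by (simp add: s_def c_def power2_eq_square algebra_simps)
  have c1: "c \<le> 1" by (simp add: c_def)
  have tw: "t w = exp x * s / \<bar>exp x * c - 1\<bar>"
    by (simp add: t_def x_def s_def c_def Re_exp Im_exp abs_mult)
  have nz: "exp x * c \<noteq> 1" using ne(3) by (simp add: x_def c_def Re_exp)
  have ex: "1 \<le> exp x" using \<open>x > 0\<close> by simp
  show ?thesis
  proof (cases "exp x * c < 1")
    \<comment> \<open>Here \<open>exp w\<close> lies to the left of \<open>1\<close>. Then
      \<open>t w < 1\<close> forces \<open>s < 1 - c\<close>, which contradicts
      \<open>s\<^sup>2 = (1 - c) * (1 + c)\<close>.\<close>
    case True
    have "c \<le> exp x * c" using ex \<open>c > 0\<close> by simp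
    have "exp x * s < 1 - exp x * c" using t(2) True by (simp add: tw field_simps)
    moreover have "s \<le> exp x * s" using ex \<open>s > 0\<close> by simp
    ultimately have "s < 1 - c" using \<open>c \<le> exp x * c\<close> by linarith
    then have "s * s < (1 - c) * (1 - c)" using \<open>s > 0\<close> by (intro mult_strict_mono) auto
    also have "\<dots> \<le> (1 - c) * (1 + c)" using c1 \<open>c > 0\<close> by (intro mult_left_mono) auto
    finally show ?thesis using sc by (simp add: power2_eq_square)
  next
    case False
    then have pos: "exp x * c - 1 > 0" using nz by simp
    \<comment> \<open>The angle of \<open>exp w\<close> at \<open>1\<close> is compared with that of
      \<open>w\<close> at \<open>0\<close>: \<open>t w\<close> is at least \<open>s / x\<close>.
      Replacing \<open>y\<close> by \<open>s\<close> loses at most a factor \<open>10/11\<close>,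
      and \<open>20/11\<close> still exceeds \<open>3/2\<close>.\<close>
    have "exp x * c - 1 \<le> exp x - 1" using c1 by simp
    also have "\<dots> \<le> x * exp x"
    proof -
      have "1 - x \<le> exp (- x)" using exp_ge_add_one_self[of "-x"] by simp
      then have "exp x * (1 - x) \<le> exp x * exp (- x)" by (intro mult_left_mono) auto
      then show ?thesis by (simp add: exp_minus field_simps)
    qed
    finally have "(exp x * c - 1) * s \<le> (x * exp x) * s" using \<open>s > 0\<close> by (intro mult_right_mono) auto
    then have "s / x \<le> t w" using pos \<open>x > 0\<close> by (simp add: tw field_simps)
    moreover have "10/11 * (y / x) \<le> s / x" using s \<open>x > 0\<close> by (simp add: field_simps)
    moreover have "t z > 0" using av by simp
    ultimately show ?thesis using quot by linarith
  qed
qed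

text \<open>Otherwise all iterates map a fixed disc into half-planes, which bounds their hyperbolic
  derivatives at its centre. The expansion factors, all at least 1, must then tend to 1. This forces
  the angle at \<open>1\<close> to remain small, although it grows by the factor \<open>3/2\<close>
  at each step.\<close>

lemma iterates_meet_real_line:
  assumes "open U" "U \<noteq> {}"
  obtains n z where "z \<in> U" "(sqexp ^^ n) z \<in> \<real>"
proof (rule ccontr)
  assume "\<not> thesis"
  then have avoid: "Im ((sqexp ^^ n) z) \<noteq> 0" if "z \<in> U" for n z
    using that \<open>\<And>z n. z \<in> U \<Longrightarrow> (sqexp ^^ n) z \<in> \<real> \<Longrightarrow> thesis\<close> by (auto simp: complex_is_Real_iff)
  obtain z where "z \<in> U" using assms by blast
  then obtain r where r: "r > 0" "ball z r \<subseteq> U" using assms openE by blast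
  define zs where "zs = (\<lambda>n. (sqexp ^^ n) z)"
  have zs_Suc: "zs (Suc n) = sqexp (zs n)" for n by (simp add: zs_def)
  have Im: "Im (zs n) \<noteq> 0" for n using avoid \<open>z \<in> U\<close> by (simp add: zs_def)
  have ImS: "Im (sqexp (zs n)) \<noteq> 0" for n using Im[of "Suc n"] by (simp add: zs_Suc)
  have ne: "Re (exp (zs n)) \<noteq> 1" "Im (exp (zs n)) \<noteq> 0" for n
    using ImS[of n] by (auto simp: Im_sqexp)
  \<comment> \<open>\<open>A\<close> is the secant of the angle whose tangent is \<open>t\<close>
    below, and \<open>P\<close> is the accumulated hyperbolic expansion along the orbit.\<close>
  define A where "A = (\<lambda>n. cmod (exp (zs n) - 1) / \<bar>Re (exp (zs n)) - 1\<bar>)"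
  define B where "B = (\<lambda>n. \<bar>Im (zs n)\<bar> / \<bar>sin (Im (zs n))\<bar>)"
  have sin: "sin (Im (zs n)) \<noteq> 0" for n using ne(2)[of n] by (auto simp: Im_exp)
  have A1: "1 \<le> A n" for n
    using ne(1)[of n] abs_Re_le_cmod[of "exp (zs n) - 1"] by (simp add: A_def le_divide_eq del: Re_exp)
  have B1: "1 \<le> B n" for n
    using sin[of n] abs_sin_x_le_abs_x[of "Im (zs n)"] by (simp add: B_def le_divide_eq)
  define P where "P = (\<lambda>n. \<Prod>k<n. A k * B k)"
  have PS: "P (Suc n) = P n * (A n * B n)" for n by (simp add: P_def)
  have deriv: "cmod (deriv (sqexp ^^ n) z) * \<bar>Im z\<bar> = \<bar>Im (zs n)\<bar> * P n" for n
  proof (induction n)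
    case (Suc n)
    have "((sqexp ^^ n) has_field_derivative deriv (sqexp ^^ n) z) (at z)"
      using holomorphic_sqexp_iterate[of n UNIV] holomorphic_derivI by blast
    from DERIV_chain[OF sqexp_has_derivative this]
    have "deriv (sqexp ^^ Suc n) z =
        of_real (2 * ln 2) * (exp (zs n) - 1) * exp (zs n) * deriv (sqexp ^^ n) z"
      by (intro DERIV_imp_deriv) (simp add: zs_def)
    then have "cmod (deriv (sqexp ^^ Suc n) z) * \<bar>Im z\<bar> =
        cmod (of_real (2 * ln 2) * (exp (zs n) - 1) * exp (zs n)) * (cmod (deriv (sqexp ^^ n) z) * \<bar>Im z\<bar>)"
      by (simp only: norm_mult mult.assoc)
    also have "\<dots> = cmod (of_real (2 * ln 2) * (exp (zs n) - 1) * exp (zs n)) * \<bar>Im (zs n)\<bar> * P n"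
      by (simp only: Suc.IH mult.assoc)
    also have "\<dots> = \<bar>Im (zs (Suc n))\<bar> * (A n * B n) * P n"
      unfolding sqexp_hyperbolic_expansion[OF ImS] A_def B_def zs_Suc ..
    finally show ?case by (simp only: PS mult_ac)
  qed (simp_all add: zs_def P_def)
  have Pbound: "P n \<le> 4 * \<bar>Im z\<bar> / r" for n
  proof -
    have "cmod (deriv (sqexp ^^ n) z) \<le> 4 * \<bar>Im (zs n)\<bar> / r"
      unfolding zs_def
      using r avoid by (intro deriv_bound_avoiding_real_line holomorphic_sqexp_iterate) auto
    then have "\<bar>Im (zs n)\<bar> * P n \<le> 4 * \<bar>Im (zs n)\<bar> / r * \<bar>Im z\<bar>"
      unfolding deriv[symmetric] by (intro mult_right_mono) auto
    then have "\<bar>Im (zs n)\<bar> * P n \<le> \<bar>Im (zs n)\<bar> * (4 * \<bar>Im z\<bar> / r)" by (simp add: mult_ac)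
    then show ?thesis by (rule mult_left_le_imp_le) (use Im[of n] in simp)
  qed
  have AB1: "1 \<le> A n * B n" for n using A1 B1 by (meson mult_ge1_I)
  have P1: "1 \<le> P n" for n unfolding P_def using AB1 by (intro prod_ge_1) auto
  have "incseq P"
    unfolding incseq_Suc_iff PS using P1 AB1 by (metis mult_left_mono mult.right_neutral order_trans zero_le_one)
  then obtain L where L: "P \<longlonglongrightarrow> L"
    using incseq_convergent[of P] Pbound by blast
  then have "L \<ge> 1" using P1 by (auto intro: LIMSEQ_le_const)
  have "(\<lambda>n. P (Suc n) / P n) \<longlonglongrightarrow> L / L"
    using L \<open>L \<ge> 1\<close> by (intro tendsto_divide LIMSEQ_Suc) auto
  moreover have "P (Suc n) / P n = A n * B n" for n
    using P1[of n] by (simp add: PS)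
  ultimately have "(\<lambda>n. A n * B n) \<longlonglongrightarrow> 1" using \<open>L \<ge> 1\<close> by simp
  then have "eventually (\<lambda>n. A n * B n < 11/10) sequentially"
    by (rule order_tendstoD) simp
  then obtain N where N: "\<And>n. n \<ge> N \<Longrightarrow> A n * B n < 11/10"
    by (auto simp: eventually_sequentially)
  define t where "t = (\<lambda>n. \<bar>Im (exp (zs n))\<bar> / \<bar>Re (exp (zs n)) - 1\<bar>)"
  have tA: "(t n)\<^sup>2 = (A n)\<^sup>2 - 1" for n
    using ne(1)[of n]
    by (simp add: t_def A_def power_divide cmod_power2 field_simps del: Re_exp Im_exp)
  \<comment> \<open>The threshold \<open>11/10\<close> for \<open>A * B\<close> serves both
    purposes: it bounds \<open>B\<close>, and \<open>(11/10)\<^sup>2 - 1 < 1/4\<close> bounds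
    \<open>t\<close>.\<close>
  have small: "t n < 1/2" "B n < 11/10" if "n \<ge> N" for n
  proof -
    have "A n \<le> A n * B n" "B n \<le> A n * B n"
      using A1[of n] B1[of n] mult_left_mono[of 1 "B n" "A n"] mult_right_mono[of 1 "A n" "B n"] by simp_all
    then have "A n < 11/10" "B n < 11/10" using N[OF that] by auto
    then show "B n < 11/10" by simp
    have "(A n)\<^sup>2 \<le> (11/10)\<^sup>2" using \<open>A n < 11/10\<close> A1[of n] by (intro power_mono) auto
    then have "(t n)\<^sup>2 < (1/2)\<^sup>2" unfolding tA by (simp add: power2_eq_square)
    then show "t n < 1/2" by (rule power_less_imp_less_base) simp
  qed
  have step: "3/2 * t n \<le> t (Suc n)" if "n \<ge> N" for n
    unfolding t_def
  proof (rule sqexp_angle_expansion)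
    show "\<bar>Im (zs (Suc n))\<bar> \<le> 11/10 * \<bar>sin (Im (zs (Suc n)))\<bar>"
      using small(2)[of "Suc n"] that sin[of "Suc n"] by (simp add: B_def field_simps)
    show "\<bar>Im (exp (zs n))\<bar> / \<bar>Re (exp (zs n)) - 1\<bar> < 1/2"
      using small(1)[OF that] by (simp only: t_def)
    show "\<bar>Im (exp (zs (Suc n)))\<bar> / \<bar>Re (exp (zs (Suc n))) - 1\<bar> < 1"
      using small(1)[of "Suc n"] that unfolding t_def by linarith
  qed (rule zs_Suc ne)+
  have grow: "t N * (3/2) ^ k \<le> t (N + k)" for k
  proof (induction k)
    case (Suc k)
    then show ?case using step[of "N + k"] by simp
  qed simp
  have "t N > 0" using ne[of N] by (simp add: t_def del: Re_exp Im_exp)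
  obtain k where "1 / (2 * t N) < (3/2) ^ k"
    using real_arch_pow[of "3/2"] by auto
  then have "1/2 < t N * (3/2) ^ k" using \<open>t N > 0\<close> by (simp add: field_simps)
  then show False using grow[of k] small(1)[of "N + k"] by simp
qed

text \<open>If the iterates omit the ray \<open>[ln 2, \<infinity>)\<close> then they form a normal family on \<open>U\<close>, with
  limit \<open>0\<close> wherever an iterate enters the basin of \<open>0\<close>, hence everywhere.\<close>
lemma iterates_meet_ray:
  assumes U: "open U" "connected U" and z: "z \<in> U" "z \<notin> bounded_orbit_set sqexp"
  obtains n w x where "w \<in> U" "(sqexp ^^ n) w = of_real x" "ln 2 \<le> x"
proof (rule ccontr)
  assume "\<not> thesis"
  then have avoid: "(sqexp ^^ n) w \<noteq> of_real x" if "w \<in> U" "ln 2 \<le> x" for n w x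
    using that \<open>\<And>w n x. w \<in> U \<Longrightarrow> (sqexp ^^ n) w = of_real x \<Longrightarrow> ln 2 \<le> x \<Longrightarrow> thesis\<close> by blast
  \<comment> \<open>\<open>\<phi>\<close> maps the complement of the ray into the unit disc: the
    root has positive real part, so adding 1 gives modulus above 1.\<close>
  define \<phi> where "\<phi> = (\<lambda>w. inverse (csqrt (of_real (ln 2) - w) + 1))"
  have nonpos: "of_real (ln 2) - (sqexp ^^ n) w \<notin> \<real>\<^sub>\<le>\<^sub>0" if "w \<in> U" for n w
  proof
    assume "of_real (ln 2) - (sqexp ^^ n) w \<in> \<real>\<^sub>\<le>\<^sub>0"
    then obtain y where "y \<le> 0" "of_real (ln 2) - (sqexp ^^ n) w = of_real y"
      by (auto elim!: nonpos_Reals_cases)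
    then have "(sqexp ^^ n) w = of_real (ln 2 - y)"
      by (simp add: algebra_simps)
    then show False using avoid[OF that, of "ln 2 - y" n] \<open>y \<le> 0\<close> by simp
  qed
  have Re: "1 < Re (csqrt (of_real (ln 2) - (sqexp ^^ n) w) + 1)" if "w \<in> U" for n w
    using Re_csqrt_pos[OF nonpos[OF that]] by (simp del: csqrt.simps)
  have nz: "csqrt (of_real (ln 2) - (sqexp ^^ n) w) + 1 \<noteq> 0" if "w \<in> U" for n w
    using Re[OF that, of n] by (metis zero_complex.sel(1) not_one_less_zero)
  have bound: "cmod (\<phi> ((sqexp ^^ n) w)) \<le> 1" if "w \<in> U" for n w
  proof -
    have "1 \<le> cmod (csqrt (of_real (ln 2) - (sqexp ^^ n) w) + 1)"
      using Re[OF that, of n] complex_Re_le_cmod order_trans less_imp_le by blast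
    then show ?thesis unfolding \<phi>_def norm_inverse by (rule inverse_le_1_iff[THEN iffD2, OF disjI2])
  qed
  have hol: "(\<lambda>w. \<phi> ((sqexp ^^ n) w)) holomorphic_on U" for n
    unfolding \<phi>_def using nonpos nz
    by (intro holomorphic_intros holomorphic_sqexp_iterate) auto
  obtain g r where g: "g holomorphic_on U" and r: "strict_mono (r :: nat \<Rightarrow> nat)"
    and lim: "\<And>w. w \<in> U \<Longrightarrow> (\<lambda>n. \<phi> ((sqexp ^^ r n) w)) \<longlonglongrightarrow> g w"
  proof (rule Montel[of U "range (\<lambda>n w. \<phi> ((sqexp ^^ n) w))" "\<lambda>n w. \<phi> ((sqexp ^^ n) w)"])
    show "\<exists>B. \<forall>h\<in>range (\<lambda>n w. \<phi> ((sqexp ^^ n) w)). \<forall>z\<in>K. cmod (h z) \<le> B"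
      if "compact K" "K \<subseteq> U" for K
      using bound that by (intro exI[of _ 1]) auto
  qed (use U hol in auto)
  obtain n w where w: "w \<in> U" "(sqexp ^^ n) w \<in> \<real>"
    using iterates_meet_real_line U(1) z(1) by blast
  then obtain x where x: "(sqexp ^^ n) w = of_real x" by (auto elim: Reals_cases)
  then have "x < ln 2" using avoid[OF w(1), of x n] by force
  then have "eventually (\<lambda>k. cmod ((sqexp ^^ k) (of_real x)) < 1/6) sequentially"
    by (intro order_tendstoD(2)[OF tendsto_norm_zero[OF real_below_tendsto_0]]) auto
  then obtain k where k: "cmod ((sqexp ^^ k) (of_real x)) < 1/6"
    by (auto simp: eventually_sequentially)
  define V where "V = U \<inter> (\<lambda>v. cmod ((sqexp ^^ (k + n)) v)) -` {..<1/6}"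
  have "open V"
    unfolding V_def using U by (intro open_Int open_vimage continuous_intros continuous_sqexp_iterate) auto
  have "w \<in> V" using k w by (simp add: V_def sqexp_iterate_add x)
  have ne0: "csqrt (of_real (ln 2) - 0) + 1 \<noteq> 0"
  proof -
    have "csqrt (of_real (ln 2) - 0) + 1 = of_real (sqrt (ln 2) + 1)" by simp
    moreover have "0 \<le> sqrt (ln 2)" by simp
    then have "sqrt (ln 2) + 1 \<noteq> 0" by linarith
    ultimately show ?thesis by (metis of_real_eq_0_iff)
  qed
  have \<phi>_lim: "(\<lambda>n. \<phi> ((sqexp ^^ r n) v)) \<longlonglongrightarrow> \<phi> 0" if "v \<in> V" for v
  proof -
    have "(\<lambda>n. (sqexp ^^ n) v) \<longlonglongrightarrow> 0"
      using that by (intro sqexp_iterate_near_0_tendsto) (auto simp: V_def)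
    then have "(\<lambda>n. (sqexp ^^ r n) v) \<longlonglongrightarrow> 0"
      using r LIMSEQ_subseq_LIMSEQ by (fastforce simp: o_def)
    moreover have "isCont \<phi> 0"
    proof -
      have "of_real (ln 2) - 0 \<notin> \<real>\<^sub>\<le>\<^sub>0" by (simp add: complex_nonpos_Reals_iff)
      then show ?thesis using ne0
        unfolding \<phi>_def by (intro continuous_intros continuous_at_csqrt isCont_o2[of _ _ csqrt]) auto
    qed
    ultimately show ?thesis by (rule isCont_tendsto_compose[rotated])
  qed
  \<comment> \<open>The limit function is constant on the open set \<open>V\<close> of points
    attracted to \<open>0\<close>, hence on all of the connected set \<open>U\<close>.\<close>
  have "g z = \<phi> 0"
  proof (rule analytic_continuation_open[of V U g "\<lambda>_. \<phi> 0"])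
    show "g v = \<phi> 0" if "v \<in> V" for v
      using LIMSEQ_unique[OF lim \<phi>_lim] that by (auto simp: V_def)
  qed (use U z g \<open>open V\<close> \<open>w \<in> V\<close> in \<open>auto simp: V_def\<close>)
  \<comment> \<open>Inverting \<open>\<phi>\<close> recovers convergence of the iterates themselves,
    so \<open>z\<close> also enters the basin of \<open>0\<close>.\<close>
  have inv: "of_real (ln 2) - (inverse (\<phi> u) - 1)\<^sup>2 = u" for u
    by (simp add: \<phi>_def del: csqrt.simps)
  have "\<phi> 0 \<noteq> 0"
    using ne0 by (simp add: \<phi>_def)
  then have "(\<lambda>n. of_real (ln 2) - (inverse (\<phi> ((sqexp ^^ r n) z)) - 1)\<^sup>2)
      \<longlonglongrightarrow> of_real (ln 2) - (inverse (\<phi> 0) - 1)\<^sup>2"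
    using lim[OF z(1)] \<open>g z = \<phi> 0\<close> by (intro tendsto_intros) auto
  then have "(\<lambda>n. (sqexp ^^ r n) z) \<longlonglongrightarrow> 0"
    by (simp only: inv)
  from order_tendstoD(2)[OF tendsto_norm_zero[OF this], of "1/6"]
  obtain m where "cmod ((sqexp ^^ r m) z) < 1/6"
    by (auto simp: eventually_sequentially)
  then show False using z(2) sqexp_iterate_near_0_bounded_orbit by blast
qed

section \<open>Blow-up along the ray\<close>

text \<open>By the open mapping property it suffices that the image of the boundary circle keeps
  distance at least \<open>exp x * r\<close> from the image of the centre. The difference of squares
  factors, and each factor is bounded below.\<close>

lemma sqexp_image_ball:
  fixes x r :: real
  assumes x: "3 \<le> x" and r: "0 < r" "r \<le> 1/4"
  shows "ball (of_real (sqexp_real x)) (exp x * r) \<subseteq> sqexp ` ball (of_real x) r"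
  unfolding sqexp_of_real[symmetric]
proof (rule ball_subset_open_map_image)
  fix z assume "z \<in> frontier (ball (complex_of_real x) r)"
  then have "cmod (z - of_real x) = r"
    using r by (simp add: dist_norm norm_minus_commute)
  then obtain u where z: "z = of_real x + u" and u: "cmod u = r"
    by (metis add.commute diff_add_cancel)
  have e1: "r / 2 \<le> cmod (exp u - 1)"
  proof -
    have "cmod ((exp u - u) - (exp 0 - 0)) \<le> 1/2 * cmod (u - 0)"
    proof (rule field_differentiable_bound[of "cball 0 (1/4)" _ "\<lambda>v. exp v - 1"])
      show "cmod (exp v - 1) \<le> 1/2" if "v \<in> cball 0 (1/4)" for v
        using that norm_exp_minus_1_le[of v] by simp
    qed (use u r in \<open>auto intro!: derivative_eq_intros\<close>)
    then have "cmod ((exp u - 1) - u) \<le> 1/2 * r" using u by (simp add: algebra_simps)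
    then show ?thesis using u norm_triangle_ineq2[of u "u - (exp u - 1)"]
      by (simp add: norm_minus_commute)
  qed
  have e2: "1 \<le> cmod (exp u + 1)"
  proof -
    have "\<bar>Im u\<bar> \<le> 1/2" using abs_Im_le_cmod[of u] u r by simp
    then have "cos (Im u) \<ge> 0" using pi_gt3 by (intro cos_ge_zero) auto
    then have "1 \<le> Re (exp u + 1)" by (simp add: Re_exp)
    then show ?thesis using complex_Re_le_cmod order_trans by blast
  qed
  have "exp x \<ge> 6"
  proof -
    have "(2::real) ^ 3 \<le> exp 1 ^ 3" using exp_ge_add_one_self[of 1] by (intro power_mono) auto
    also have "\<dots> = exp 3" by (simp flip: exp_of_nat_mult)
    also have "\<dots> \<le> exp x" using x by simp
    finally show ?thesis by simp
  qed
  have eq: "sqexp z - sqexp (of_real x) =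
      of_real (ln 2) * (of_real (exp x) * (exp u - 1)) * (of_real (exp x) * (exp u + 1) - 2)"
    by (simp add: sqexp_def z exp_add exp_of_real power2_eq_square algebra_simps)
  have "exp x - 2 \<le> exp x * cmod (exp u + 1) - 2"
    using e2 by simp
  also have "\<dots> \<le> cmod (of_real (exp x) * (exp u + 1) - 2)"
    using norm_triangle_ineq2[of "of_real (exp x) * (exp u + 1)" 2] by (simp add: norm_mult)
  finally have e3: "4 \<le> cmod (of_real (exp x) * (exp u + 1) - 2)" using \<open>exp x \<ge> 6\<close> by simp
  have "exp x * r \<le> (1/2 * (exp x * (r / 2))) * 4" by simp
  also have "\<dots> \<le> (ln 2 * (exp x * cmod (exp u - 1))) * cmod (of_real (exp x) * (exp u + 1) - 2)"
    using e1 e3 r ln2_ge_two_thirds by (intro mult_mono) auto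
  also have "\<dots> = cmod (sqexp z - sqexp (of_real x))"
    unfolding eq by (simp add: norm_mult)
  finally show "exp x * r \<le> cmod (sqexp z - sqexp (of_real x))" .
qed (use r in \<open>auto intro!: holomorphic_on_imp_continuous_on holomorphic_sqexp open_sqexp_image\<close>)

text \<open>A logarithm of \<open>w\<close> is shifted by a multiple of \<open>2 * pi * \<i>\<close>
  until its imaginary part lies in the prescribed window.\<close>

lemma exp_image_rectangle:
  fixes a b c :: real
  assumes "exp a \<le> cmod w" "cmod w \<le> exp b"
  obtains z where "exp z = w" "a \<le> Re z" "Re z \<le> b" "c \<le> Im z" "Im z \<le> c + 2 * pi"
proof -
  have "w \<noteq> 0" using assms(1) exp_gt_zero[of a] by auto
  define k where "k = \<lceil>(c - Arg w) / (2 * pi)\<rceil>"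
  define z where "z = Complex (ln (cmod w)) (Arg w + 2 * pi * of_int k)"
  have "exp z = w"
  proof -
    have "z = of_real (ln (cmod w)) + \<i> * of_real (Arg w) + 2 * of_int k * pi * \<i>"
      by (simp add: z_def complex_eq_iff)
    then have "exp z = exp (of_real (ln (cmod w))) * exp (\<i> * of_real (Arg w)) * exp (2 * of_int k * pi * \<i>)"
      by (simp add: exp_add)
    also have "exp (2 * of_int k * pi * \<i>) = 1"
      by (auto simp: exp_eq_1)
    also have "exp (of_real (ln (cmod w))) = (of_real (cmod w) :: complex)"
      using \<open>w \<noteq> 0\<close> by (simp add: exp_of_real del: of_real_exp flip: of_real_exp)
    finally show ?thesis using Arg_eq[OF \<open>w \<noteq> 0\<close>] by simp
  qed
  moreover have "a \<le> Re z" "Re z \<le> b"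
  proof -
    have "exp (Re z) = cmod w" using \<open>exp z = w\<close> norm_exp_eq_Re by metis
    then show "a \<le> Re z" "Re z \<le> b" using assms by (metis exp_le_cancel_iff)+
  qed
  moreover have "c \<le> Im z" "Im z \<le> c + 2 * pi"
  proof -
    have "(c - Arg w) / (2 * pi) \<le> of_int k" "of_int k \<le> (c - Arg w) / (2 * pi) + 1"
      unfolding k_def by (linarith+)
    then show "c \<le> Im z" "Im z \<le> c + 2 * pi"
      by (simp_all add: z_def field_simps)
  qed
  ultimately show ?thesis using that by blast
qed

lemma ln2_sq_root:
  obtains s :: complex where "of_real (ln 2) * s\<^sup>2 = p" "cmod s = sqrt (cmod p / ln 2)"
proof
  define s where "s = csqrt (p / of_real (ln 2))"
  have sq: "s\<^sup>2 = p / of_real (ln 2)" unfolding s_def by (rule power2_csqrt)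
  then show "of_real (ln 2) * s\<^sup>2 = p" by simp
  have "(cmod s)\<^sup>2 = cmod p / ln 2"
    unfolding norm_power[symmetric] sq by (simp add: norm_divide)
  then show "cmod s = sqrt (cmod p / ln 2)" by (metis norm_ge_zero real_sqrt_unique)
qed

text \<open>With \<open>p = ln 2 * s\<^sup>2\<close> it remains to solve
  \<open>exp z = s + 1\<close>. The moduli of \<open>s\<close> and \<open>s + 1\<close> differ by at
  most 1, which explains the shifts by 1 in the radii.\<close>

lemma sqexp_image_rectangle_annulus:
  assumes "ln 2 * (exp a + 1)\<^sup>2 \<le> cmod p" "cmod p \<le> ln 2 * (exp b - 1)\<^sup>2" "0 \<le> b"
  obtains z where "sqexp z = p" "a \<le> Re z" "Re z \<le> b" "c \<le> Im z" "Im z \<le> c + 2 * pi"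
proof -
  obtain s where s: "of_real (ln 2) * s\<^sup>2 = p" "cmod s = sqrt (cmod p / ln 2)"
    by (rule ln2_sq_root)
  have "exp a + 1 \<le> cmod s"
    unfolding s(2) using assms(1) by (intro real_le_rsqrt) (simp add: field_simps)
  moreover have "cmod s \<le> exp b - 1"
    unfolding s(2) using assms(2,3) by (intro real_le_lsqrt) (auto simp: field_simps)
  moreover have "cmod s - 1 \<le> cmod (s + 1)" "cmod (s + 1) \<le> cmod s + 1"
    using norm_triangle_ineq2[of s "-1"] norm_triangle_ineq[of s 1] by auto
  ultimately have "exp a \<le> cmod (s + 1)" "cmod (s + 1) \<le> exp b" by linarith+
  then obtain z where "exp z = s + 1" "a \<le> Re z" "Re z \<le> b" "c \<le> Im z" "Im z \<le> c + 2 * pi"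
    by (rule exp_image_rectangle)
  moreover from this have "sqexp z = p" using s(1) by (simp add: sqexp_def)
  ultimately show ?thesis using that by blast
qed

text \<open>Of the two candidates \<open>1 \<plusminus> s\<close> for \<open>exp z\<close>, one has modulus at least \<open>1\<close>.\<close>
lemma sqexp_image_rectangle_disc:
  assumes "cmod p \<le> ln 2 * (exp b - 1)\<^sup>2" "0 \<le> b"
  obtains z where "sqexp z = p" "0 \<le> Re z" "Re z \<le> b" "c \<le> Im z" "Im z \<le> c + 2 * pi"
proof -
  obtain s0 where s0: "of_real (ln 2) * s0\<^sup>2 = p" "cmod s0 = sqrt (cmod p / ln 2)"
    by (rule ln2_sq_root)
  define s where "s = (if Re s0 \<ge> 0 then s0 else - s0)"
  have s: "of_real (ln 2) * s\<^sup>2 = p" "cmod s = sqrt (cmod p / ln 2)" "Re s \<ge> 0"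
    using s0 by (auto simp: s_def)
  have "cmod s \<le> exp b - 1"
    unfolding s(2) using assms by (intro real_le_lsqrt) (auto simp: field_simps)
  moreover have "cmod (s + 1) \<le> cmod s + 1"
    using norm_triangle_ineq[of s 1] by auto
  moreover have "1 \<le> cmod (s + 1)" using complex_Re_le_cmod[of "s + 1"] s(3) by simp
  ultimately have "exp 0 \<le> cmod (s + 1)" "cmod (s + 1) \<le> exp b" by auto
  then obtain z where "exp z = s + 1" "0 \<le> Re z" "Re z \<le> b" "c \<le> Im z" "Im z \<le> c + 2 * pi"
    by (rule exp_image_rectangle)
  moreover from this have "sqexp z = p" using s(1) by (simp add: sqexp_def)
  ultimately show ?thesis using that by blast
qed

text \<open>The first application covers an annulus around \<open>0\<close>. The annulus contains a
  rectangle of height \<open>2 * pi\<close> which the second application maps over the disc.\<close>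

lemma sqexp_twice_image_ball:
  assumes R: "0 \<le> R" and y: "R + 10 \<le> y"
  shows "ball 0 R \<subseteq> sqexp ` sqexp ` ball (of_real y) 10"
proof
  fix p :: complex assume p: "p \<in> ball 0 R"
  \<comment> \<open>\<open>c\<close> is the inner radius of the annulus. Imaginary part at least
    \<open>c\<close> keeps the rectangle outside the inner disc.\<close>
  define E c where "E = exp (y - 5)" and "c = ln 2 * (E + 1)\<^sup>2"
  have "R + 6 \<le> E" using y exp_ge_add_one_self[of "y - 5"] by (simp add: E_def)
  then have "1 \<le> E" using R by simp
  have "c \<ge> 0" by (simp add: c_def)
  \<comment> \<open>The left side bounds the modulus on the rectangle, the right side is the outer
    radius. Real parts within 5 of \<open>y\<close> and imaginary parts within \<open>pi\<close> of
    \<open>0\<close> fit into the ball of radius 10.\<close>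
  have room: "R + 1 + 2 * pi + c \<le> ln 2 * (exp (y + 5) - 1)\<^sup>2"
  proof -
    have "(2::real) ^ 10 \<le> exp 1 ^ 10" using exp_ge_add_one_self[of 1] by (intro power_mono) auto
    also have "\<dots> = exp 10" by (simp flip: exp_of_nat_mult)
    finally have "1000 * E \<le> exp 10 * E" using \<open>1 \<le> E\<close> by (intro mult_right_mono) auto
    also have "\<dots> = exp (y + 5)" by (simp add: E_def flip: exp_add)
    finally have "10 * E \<le> exp (y + 5) - 1" using \<open>1 \<le> E\<close> by linarith
    then have "(10 * E)\<^sup>2 \<le> (exp (y + 5) - 1)\<^sup>2" using \<open>1 \<le> E\<close> by (intro power_mono) auto
    then have big: "ln 2 * (10 * E)\<^sup>2 \<le> ln 2 * (exp (y + 5) - 1)\<^sup>2" by simp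
    have "(E + 1)\<^sup>2 \<le> (2 * E)\<^sup>2" using \<open>1 \<le> E\<close> by (intro power_mono) auto
    then have "c \<le> ln 2 * (2 * E)\<^sup>2" by (simp add: c_def)
    moreover have "ln 2 * (2 * E)\<^sup>2 + ln 2 * (96 * E\<^sup>2) = ln 2 * (10 * E)\<^sup>2"
      by (simp add: algebra_simps power2_eq_square)
    moreover have "2/3 * (96 * E\<^sup>2) \<le> ln 2 * (96 * E\<^sup>2)"
      using ln2_ge_two_thirds by (intro mult_right_mono) auto
    moreover have "E \<le> E\<^sup>2" using \<open>1 \<le> E\<close> by (simp add: power2_eq_square)
    ultimately show ?thesis using big \<open>R + 6 \<le> E\<close> pi_less_4 R by linarith
  qed
  have "cmod p \<le> ln 2 * (exp (R + 1) - 1)\<^sup>2"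
  proof -
    have "R \<le> 2/3 * (R + 1)\<^sup>2" using R mult_nonneg_nonneg[OF R R]
      by (simp add: power2_eq_square field_simps)
    also have "\<dots> \<le> ln 2 * (exp (R + 1) - 1)\<^sup>2"
      using ln2_ge_two_thirds R exp_ge_add_one_self[of "R + 1"]
      by (intro mult_mono power_mono) auto
    finally show ?thesis using p by simp
  qed
  then obtain z where z: "sqexp z = p" "0 \<le> Re z" "Re z \<le> R + 1" "c \<le> Im z" "Im z \<le> c + 2 * pi"
    by (rule sqexp_image_rectangle_disc[where c = c]) (use R in auto)
  have "ln 2 * (exp (y - 5) + 1)\<^sup>2 \<le> cmod z"
    unfolding E_def[symmetric] c_def[symmetric] using z(4) abs_Im_le_cmod[of z] by linarith
  moreover have "cmod z \<le> ln 2 * (exp (y + 5) - 1)\<^sup>2"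
    using room cmod_le[of z] z \<open>c \<ge> 0\<close> by linarith
  ultimately obtain u where u: "sqexp u = z" "y - 5 \<le> Re u" "Re u \<le> y + 5" "- pi \<le> Im u" "Im u \<le> - pi + 2 * pi"
    by (rule sqexp_image_rectangle_annulus[where c = "- pi"]) (use y R in auto)
  have "cmod (u - of_real y) \<le> \<bar>Re u - y\<bar> + \<bar>Im u\<bar>" using cmod_le[of "u - of_real y"] by simp
  also have "\<dots> < 10" using u pi_less_4 by (simp add: abs_if)
  finally have "u \<in> ball (of_real y) 10" by (simp add: dist_norm norm_minus_commute)
  then show "p \<in> sqexp ` sqexp ` ball (of_real y) 10" using u(1) z(1) by blast
qed

text \<open>An escaping real point of \<open>V\<close> carries a small ball along its orbit. The
  radius at least doubles until it reaches \<open>1/4\<close>; one more step gives radius 10, and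
  two further steps cover the disc.\<close>

lemma ray_blowup:
  assumes V: "open V" "of_real x0 \<in> V" and x0: "ln 2 \<le> x0"
  obtains m where "ball 0 R \<subseteq> (sqexp ^^ m) ` V"
proof -
  obtain e where e: "e > 0" "ball (of_real x0) e \<subseteq> V" using V openE by blast
  \<comment> \<open>The point is moved to the right because \<open>x0\<close> may be the fixed point
    \<open>ln 2\<close> itself.\<close>
  define x where "x = (\<lambda>n. (sqexp_real ^^ n) (x0 + e / 2))"
  have "of_real (x0 + e / 2) \<in> V"
    using e by (intro subsetD[OF e(2)]) (simp add: dist_norm)
  then have xV: "of_real (x n) \<in> (sqexp ^^ n) ` V" for n
    unfolding x_def by (metis sqexp_iterate_of_real image_eqI)
  have x_Suc: "x (Suc n) = sqexp_real (x n)" for n by (simp add: x_def)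
  have lim: "filterlim x at_top sequentially"
    unfolding x_def using e x0 by (intro real_above_at_top) auto
  \<comment> \<open>\<open>40\<close> makes \<open>exp (x n) * (1/4)\<close> at least 10, and
    \<open>\<bar>R\<bar>\<close> leaves room for the final two steps.\<close>
  then obtain N where N: "\<And>n. n \<ge> N \<Longrightarrow> 40 + \<bar>R\<bar> \<le> x n"
    unfolding filterlim_at_top eventually_sequentially by meson
  obtain r where r: "r > 0" "ball (of_real (x N)) r \<subseteq> (sqexp ^^ N) ` V"
    using open_sqexp_iterate_image[OF V(1)] xV openE by blast
  have image: "ball (of_real (x (Suc n))) (exp (x n) * d) \<subseteq> (sqexp ^^ Suc n) ` V"
    if "ball (of_real (x n)) d \<subseteq> (sqexp ^^ n) ` V" "n \<ge> N" "0 < d" "d \<le> 1/4" for n d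
  proof -
    have "ball (of_real (x (Suc n))) (exp (x n) * d) \<subseteq> sqexp ` ball (of_real (x n)) d"
      unfolding x_Suc using that N[of n] by (intro sqexp_image_ball) auto
    also have "\<dots> \<subseteq> sqexp ` (sqexp ^^ n) ` V" using that by (intro image_mono)
    finally show ?thesis by (simp add: image_comp)
  qed
  have big: "40 \<le> exp (x n)" if "n \<ge> N" for n
    using N[OF that] exp_ge_add_one_self[of "x n"] by linarith
  \<comment> \<open>The cap \<open>1/4\<close> is the largest radius for which the expansion
    estimate \<open>sqexp_image_ball\<close> is available.\<close>
  define d where "d = (\<lambda>k. min (1/4) (r * 2 ^ k))"
  have d: "0 < d k" "d k \<le> 1/4" for k using r by (auto simp: d_def)
  have balls: "ball (of_real (x (N + k))) (d k) \<subseteq> (sqexp ^^ (N + k)) ` V" for k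
  proof (induction k)
    case 0
    have "ball (complex_of_real (x N)) (d 0) \<subseteq> ball (of_real (x N)) r" by (intro subset_ball) (simp add: d_def)
    then show ?case using r(2) by simp
  next
    case (Suc k)
    have "d (Suc k) \<le> 2 * d k" by (simp add: d_def min_def)
    also have "\<dots> \<le> exp (x (N + k)) * d k" using big[of "N + k"] d[of k] by (intro mult_right_mono) auto
    finally have "ball (complex_of_real (x (N + Suc k))) (d (Suc k)) \<subseteq> ball (of_real (x (Suc (N + k)))) (exp (x (N + k)) * d k)"
      by (simp add: subset_ball)
    also have "\<dots> \<subseteq> (sqexp ^^ Suc (N + k)) ` V" using Suc d by (intro image) auto
    finally show ?case by (simp only: add_Suc_right)
  qed
  obtain k where "1 / (4 * r) < 2 ^ k" using real_arch_pow[of 2] by auto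
  then have "d k = 1/4" using r by (simp add: d_def field_simps min_def)
  define n where "n = Suc (N + k)"
  have "ball (complex_of_real (x n)) 10 \<subseteq> ball (of_real (x n)) (exp (x (N + k)) * (1/4))"
    using big[of "N + k"] by (intro subset_ball) auto
  also have "\<dots> \<subseteq> (sqexp ^^ n) ` V"
    unfolding n_def using balls[of k] \<open>d k = 1/4\<close> by (intro image) auto
  finally have "sqexp ` sqexp ` ball (of_real (x n)) 10 \<subseteq> sqexp ` sqexp ` (sqexp ^^ n) ` V"
    by (intro image_mono)
  moreover have "ball 0 \<bar>R\<bar> \<subseteq> sqexp ` sqexp ` ball (of_real (x n)) 10"
    using N[of n] by (intro sqexp_twice_image_ball) (auto simp: n_def)
  moreover have "ball (0::complex) R \<subseteq> ball 0 \<bar>R\<bar>" by (intro subset_ball) auto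
  moreover have "sqexp ` sqexp ` (sqexp ^^ n) ` V = (sqexp ^^ Suc (Suc n)) ` V"
    by (simp add: image_comp o_def)
  ultimately have "ball 0 R \<subseteq> (sqexp ^^ Suc (Suc n)) ` V" by simp
  then show ?thesis by (rule that)
qed

section \<open>Bungee points on frontiers\<close>

text \<open>A curve around \<open>cball 0 (2 * pi)\<close> crosses the left half-plane, where \<open>exp\<close> turns a
  crossing of a strip of height \<open>2\<pi>\<close> into a small curve around \<open>0\<close>.\<close>
lemma exp_left_half_plane:
  assumes H: "open H" "bounded H" "ball (0::complex) 9 \<subseteq> H"
  obtains T where "open T" "0 \<in> T" "T \<subseteq> ball 0 1" "frontier T \<subseteq> exp ` frontier H"
proof -
  define K where "K = closure H \<inter> {z. Re z \<le> 0}"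
  define T where "T = ball 0 1 - exp ` K"
  have "compact K"
    unfolding K_def using H by (intro compact_Int_closed closed_halfspace_Re_le) auto
  then have "compact (exp ` K)"
    by (intro compact_continuous_image continuous_intros)
  then have "open T" unfolding T_def by (intro open_Diff compact_imp_closed) auto
  have inside: "w \<notin> closure T" if w: "w = exp z" "z \<in> H" "Re z \<le> 0" for w z
  proof -
    have "open (exp ` H)"
    proof (rule open_mapping_thm[of exp UNIV])
      have "exp 0 \<noteq> exp (of_real pi * \<i>)" by simp
      then show "\<not> (exp :: complex \<Rightarrow> complex) constant_on UNIV"
        unfolding constant_on_def by (metis UNIV_I)
    qed (use H in \<open>auto intro!: holomorphic_intros\<close>)
    have "v \<notin> T" if v: "v \<in> exp ` H" for v
    proof
      assume "v \<in> T"
      then have "cmod v < 1" by (simp add: T_def)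
      obtain u where u: "v = exp u" "u \<in> H" using v by blast
      then have "Re u < 0" using \<open>cmod v < 1\<close> by simp
      then have "u \<in> K" using subsetD[OF closure_subset u(2)] by (simp add: K_def)
      then have "v \<in> exp ` K" using u(1) by blast
      then show False using \<open>v \<in> T\<close> by (simp add: T_def)
    qed
    then have "exp ` H \<inter> closure T = {}"
      using \<open>open (exp ` H)\<close> open_Int_closure_eq_empty by blast
    then show ?thesis using w by blast
  qed
  have "frontier T \<subseteq> exp ` frontier H"
  proof
    fix w assume "w \<in> frontier T"
    then have w: "w \<in> closure T" "w \<notin> T" using \<open>open T\<close> by (auto simp: frontier_def interior_open)
    have "closure T \<subseteq> cball 0 1" by (intro closure_minimal) (auto simp: T_def)
    then have "cmod w \<le> 1" using w by auto
    \<comment> \<open>A point of the unit circle has a logarithm between \<open>0\<close> and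
      \<open>2 * pi * \<i>\<close>. This segment lies in \<open>H\<close> because the radius 9
      exceeds \<open>2 * pi\<close>.\<close>
    have "cmod w \<noteq> 1"
    proof
      assume 1: "cmod w = 1"
      obtain z where z: "exp z = w" "0 \<le> Re z" "Re z \<le> 0" "0 \<le> Im z" "Im z \<le> 0 + 2 * pi"
        by (rule exp_image_rectangle[of 0 w 0 0]) (use 1 in auto)
      have "cmod z < 9" using cmod_le[of z] z pi_less_4 by simp
      then have "z \<in> H" using H(3) by auto
      then show False using inside z w by force
    qed
    then have "w \<in> exp ` K" using \<open>cmod w \<le> 1\<close> w(2) by (auto simp: T_def)
    then obtain z where z: "w = exp z" "z \<in> closure H" "Re z \<le> 0" by (auto simp: K_def)
    then have "z \<notin> H" using inside w(1) by blast
    then show "w \<in> exp ` frontier H" using z H(1) by (auto simp: frontier_def interior_open)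
  qed
  moreover have "0 \<in> T" "T \<subseteq> ball 0 1" by (auto simp: T_def)
  ultimately show ?thesis using that \<open>open T\<close> by blast
qed

text \<open>Write \<open>sqexp\<close> as \<open>Q\<close> after \<open>exp\<close>. The
  neighbourhood \<open>T\<close> of \<open>0\<close> goes to a neighbourhood of
  \<open>Q 0 = ln 2\<close>, to which \<open>ray_blowup\<close> applies. The bound 3 holds since
  \<open>\<bar>w - 1\<bar> \<le> 2\<close> on \<open>T\<close> and
  \<open>4 * ln 2 < 3\<close>.\<close>

lemma bungee_step:
  assumes H: "open H" "bounded H" "ball 0 9 \<subseteq> H"
  obtains m H' where "m > 0" "open H'" "bounded H'" "ball 0 R \<subseteq> H'"
    "frontier H' \<subseteq> (sqexp ^^ m) ` {y \<in> frontier H. cmod (sqexp y) \<le> 3}"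
proof -
  obtain T where T: "open T" "0 \<in> T" "T \<subseteq> ball 0 1" "frontier T \<subseteq> exp ` frontier H"
    using exp_left_half_plane[OF H] by blast
  define Q :: "complex \<Rightarrow> complex" where "Q = (\<lambda>w. of_real (ln 2) * (w - 1)\<^sup>2)"
  have Q_hol: "Q holomorphic_on S" for S unfolding Q_def by (intro holomorphic_intros)
  have "open (Q ` T)"
  proof (rule open_mapping_thm[of Q UNIV])
    have "Q 0 \<noteq> Q 1" by (simp add: Q_def)
    then show "\<not> Q constant_on UNIV" unfolding constant_on_def by (metis UNIV_I)
  qed (use T Q_hol in auto)
  have "frontier (Q ` T) \<subseteq> Q ` frontier T"
    using \<open>open (Q ` T)\<close> T(3) bounded_ball bounded_subset
    by (intro frontier_image_subset holomorphic_on_imp_continuous_on Q_hol) blast+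
  also have "\<dots> \<subseteq> Q ` exp ` frontier H" using T(4) by (rule image_mono)
  also have "\<dots> = sqexp ` frontier H" by (simp add: image_image Q_def sqexp_def)
  finally have fr: "frontier (Q ` T) \<subseteq> sqexp ` frontier H" .
  have small: "Q ` T \<subseteq> cball 0 3"
  proof safe
    fix w assume "w \<in> T"
    then have "cmod w < 1" using T by auto
    then have "cmod (w - 1) \<le> 2" using norm_triangle_ineq4[of w 1] by simp
    then have "(cmod (w - 1))\<^sup>2 \<le> 2\<^sup>2" by (intro power_mono) auto
    then have "ln 2 * (cmod (w - 1))\<^sup>2 \<le> 25/36 * 2\<^sup>2"
      using ln2_le_25_over_36 by (intro mult_mono) auto
    then show "Q w \<in> cball 0 3" by (simp add: Q_def norm_mult norm_power)
  qed
  then have "frontier (Q ` T) \<subseteq> cball 0 3"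
    using closure_minimal[OF small] by (auto simp: frontier_def)
  with fr have fr3: "frontier (Q ` T) \<subseteq> sqexp ` {y \<in> frontier H. cmod (sqexp y) \<le> 3}"
    by fastforce
  have "of_real (ln 2) \<in> Q ` T" using T(2) by (auto simp: Q_def intro!: image_eqI[of _ _ 0])
  then obtain m where m: "ball 0 R \<subseteq> (sqexp ^^ m) ` (Q ` T)"
    using ray_blowup[OF \<open>open (Q ` T)\<close>] by blast
  have bdd: "bounded (Q ` T)" using small bounded_cball bounded_subset by blast
  have "frontier ((sqexp ^^ m) ` (Q ` T)) \<subseteq> (sqexp ^^ m) ` frontier (Q ` T)"
    using \<open>open (Q ` T)\<close> bdd by (rule frontier_sqexp_iterate_image)
  also have "\<dots> \<subseteq> (sqexp ^^ m) ` sqexp ` {y \<in> frontier H. cmod (sqexp y) \<le> 3}"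
    using fr3 by (rule image_mono)
  also have "\<dots> = (sqexp ^^ Suc m) ` {y \<in> frontier H. cmod (sqexp y) \<le> 3}"
    by (simp only: image_comp funpow_Suc_right)
  finally show ?thesis
    by (intro that[of "Suc m" "(sqexp ^^ m) ` (Q ` T)"] m open_sqexp_iterate_image
        bounded_sqexp_iterate_image bdd \<open>open (Q ` T)\<close>) auto
qed

text \<open>Iterating \<open>bungee_step\<close> gives domains containing ever larger discs. A
  frontier point of \<open>G\<close> whose orbit visits all their frontiers is unbounded, but
  returns to the disc of radius 3 right after each visit.\<close>

lemma frontier_meets_bungee_set:
  assumes G: "open G" "bounded G" "ball 0 9 \<subseteq> G"
  shows "frontier G \<inter> bungee_set sqexp \<noteq> {}"
proof -
  \<comment> \<open>\<open>s\<close> counts the iterations performed so far. The radius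
    \<open>9 + real j\<close> stays large enough to repeat the step and also tends to
    infinity.\<close>
  define good where "good = (\<lambda>j (H, s::nat). open H \<and> bounded H \<and> ball (0::complex) (9 + real j) \<subseteq> H \<and> (j = 0 \<longrightarrow> H = G \<and> s = 0))"
  define link where "link = (\<lambda>(H, s) (H', s'). s < s' \<and>
      frontier H' \<subseteq> (sqexp ^^ (s' - s)) ` {y \<in> frontier H. cmod (sqexp y) \<le> 3})"
  have "\<exists>g. \<forall>j. good j (g j) \<and> link (g j) (g (Suc j))"
  proof (rule dependent_nat_choice)
    show "\<exists>a. good 0 a"
      using G by (intro exI[of _ "(G, 0)"]) (simp add: good_def)
    fix a j assume "good j a"
    then obtain H s where a: "a = (H, s)" "open H" "bounded H" "ball (0::complex) (9 + real j) \<subseteq> H"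
      by (cases a) (auto simp: good_def)
    have "ball (0::complex) 9 \<subseteq> ball 0 (9 + real j)" by (intro subset_ball) simp
    then have "ball 0 9 \<subseteq> H" using a by blast
    from bungee_step[OF a(2,3) this, of "9 + real (Suc j)"]
    obtain m H' where "m > 0" "open H'" "bounded H'" "ball 0 (9 + real (Suc j)) \<subseteq> H'"
      "frontier H' \<subseteq> (sqexp ^^ m) ` {y \<in> frontier H. cmod (sqexp y) \<le> 3}" .
    then show "\<exists>b. good (Suc j) b \<and> link a b"
      by (intro exI[of _ "(H', s + m)"]) (simp add: good_def link_def a)
  qed
  then obtain g where g: "\<And>j. good j (g j)" "\<And>j. link (g j) (g (Suc j))" by blast
  define H s where "H = (\<lambda>j. fst (g j))" and "s = (\<lambda>j. snd (g j))"
  have H: "open (H j)" "bounded (H j)" "ball 0 (9 + real j) \<subseteq> H j" for j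
    using g(1)[of j] by (auto simp: good_def H_def split: prod.splits)
  have H0: "H 0 = G" "s 0 = 0"
    using g(1)[of 0] by (auto simp: good_def H_def s_def split: prod.splits)
  have s_less: "s j < s (Suc j)" for j
    using g(2)[of j] by (auto simp: link_def s_def split: prod.splits)
  have link: "frontier (H (Suc j)) \<subseteq> (sqexp ^^ (s (Suc j) - s j)) ` {y \<in> frontier (H j). cmod (sqexp y) \<le> 3}" for j
    using g(2)[of j] by (auto simp: link_def s_def H_def split: prod.splits)
  have s_mono: "strict_mono s" using s_less by (simp add: strict_mono_Suc_iff)
  define C where "C = (\<lambda>j. {z \<in> frontier G. \<forall>i<j. (sqexp ^^ s i) z \<in> frontier (H i) \<and>
      cmod ((sqexp ^^ Suc (s i)) z) \<le> 3})"
  \<comment> \<open>Following the links backwards yields a point of \<open>frontier G\<close> with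
    the prescribed itinerary, so no \<open>C j\<close> is empty.\<close>
  have pull: "\<exists>z\<in>C j. (sqexp ^^ s j) z = p" if "p \<in> frontier (H j)" for j p
    using that
  proof (induction j arbitrary: p)
    case 0
    then show ?case by (simp add: C_def H0)
  next
    case (Suc j)
    then obtain y where y: "y \<in> frontier (H j)" "cmod (sqexp y) \<le> 3" "p = (sqexp ^^ (s (Suc j) - s j)) y"
      using link by blast
    obtain z where z: "z \<in> C j" "(sqexp ^^ s j) z = y" using Suc.IH[OF y(1)] by blast
    have "z \<in> C (Suc j)" using z y by (auto simp: C_def less_Suc_eq)
    moreover have "(sqexp ^^ s (Suc j)) z = p"
      using s_less[of j] sqexp_iterate_add[of "s (Suc j) - s j" "s j" z] z y by simp
    ultimately show ?case by blast
  qed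
  have "(\<Inter>j. C j) \<noteq> {}"
  proof (rule compact_nest)
    show "compact (C j)" for j
    proof -
      have "C j = frontier G \<inter> (\<Inter>i\<in>{..<j}. (sqexp ^^ s i) -` frontier (H i) \<inter> (sqexp ^^ Suc (s i)) -` cball 0 3)"
        by (auto simp: C_def)
      moreover have "closed ((sqexp ^^ k) -` S)" if "closed S" for k S
        using that by (intro closed_vimage continuous_sqexp_iterate)
      ultimately show ?thesis
        using G(2) by (auto simp: compact_frontier_bounded intro!: compact_Int_closed closed_INT closed_Int
          simp del: funpow.simps)
    qed
    show "C j \<noteq> {}" for j
    proof -
      have "0 \<in> H j" using H(3)[of j] by auto
      moreover have "H j \<noteq> UNIV" using H(2)[of j] not_bounded_UNIV by metis
      ultimately have "frontier (H j) \<noteq> {}" by (intro frontier_not_empty) auto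
      then show ?thesis using pull by blast
    qed
    show "C n \<subseteq> C m" if "m \<le> n" for m n
      using that by (auto simp: C_def)
  qed
  then obtain z where "\<And>j. z \<in> C j" by blast
  then have z: "z \<in> frontier G" "\<And>i. (sqexp ^^ s i) z \<in> frontier (H i)" "\<And>i. cmod ((sqexp ^^ Suc (s i)) z) \<le> 3"
    by (auto simp: C_def simp del: funpow.simps)
  have "z \<notin> escaping_set sqexp"
  proof
    assume "z \<in> escaping_set sqexp"
    then have "filterlim (\<lambda>n. cmod ((sqexp ^^ n) z)) at_top sequentially"
      by (simp add: escaping_set_def filterlim_at_infinity_conv_norm_at_top)
    then obtain N where N: "\<And>n. n \<ge> N \<Longrightarrow> 4 \<le> cmod ((sqexp ^^ n) z)"
      unfolding filterlim_at_top eventually_sequentially by meson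
    have "N \<le> Suc (s N)" using seq_suble[OF s_mono, of N] by simp
    from N[OF this] z(3)[of N] show False by simp
  qed
  moreover have "z \<notin> bounded_orbit_set sqexp"
  proof
    assume "z \<in> bounded_orbit_set sqexp"
    then obtain K where K: "\<And>n. cmod ((sqexp ^^ n) z) < K" by (auto simp: bounded_orbit_set_def)
    obtain j where j: "K < real j" using reals_Archimedean2 by blast
    have "(sqexp ^^ s j) z \<notin> H j" using z(2)[of j] H(1)[of j] by (simp add: frontier_def interior_open)
    then have "9 + real j \<le> cmod ((sqexp ^^ s j) z)" using H(3)[of j] by (meson mem_ball_0 not_less subsetD)
    then show False using K[of "s j"] j by simp
  qed
  ultimately show ?thesis using z(1) by (auto simp: bungee_set_def)
qed

section \<open>Pulling frontier points back, and the three sets\<close>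

lemma escaping_set_Int_bounded_orbit_set: "escaping_set f \<inter> bounded_orbit_set f = {}"
proof -
  have False if "filterlim (\<lambda>n. (f ^^ n) z) at_infinity sequentially" "\<And>n. norm ((f ^^ n) z) < K" for z K
  proof -
    have "filterlim (\<lambda>n. norm ((f ^^ n) z)) at_top sequentially"
      using that(1) by (simp add: filterlim_at_infinity_conv_norm_at_top)
    then have "eventually (\<lambda>n. K \<le> norm ((f ^^ n) z)) sequentially"
      by (simp add: filterlim_at_top)
    then show False using that(2) by (auto simp: eventually_sequentially not_le[symmetric])
  qed
  then show ?thesis by (auto simp: escaping_set_def bounded_orbit_set_def)
qed

text \<open>By complements, this is forward invariance of the escaping set and of the bounded orbit
  set.\<close>

lemma bungee_set_iterate:
  assumes "(f ^^ n) z \<in> bungee_set f"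
  shows "z \<in> bungee_set f"
proof -
  have "(f ^^ n) z \<in> escaping_set f" if "z \<in> escaping_set f"
  proof -
    have "filterlim (\<lambda>k. (f ^^ (k + n)) z) at_infinity sequentially"
      using that filterlim_compose[OF _ filterlim_add_const_nat_at_top, of "\<lambda>k. (f ^^ k) z"]
      by (simp add: escaping_set_def)
    then show ?thesis by (simp add: escaping_set_def funpow_add)
  qed
  moreover have "(f ^^ n) z \<in> bounded_orbit_set f" if "z \<in> bounded_orbit_set f"
    using that unfolding bounded_orbit_set_def mem_Collect_eq by (metis comp_apply funpow_add)
  ultimately show ?thesis using assms by (auto simp: bungee_set_def)
qed

lemma frontier_iterate_pullback:
  assumes "open G" "bounded G" "frontier ((sqexp ^^ n) ` G) \<inter> S \<noteq> {}"
    and "\<And>z. (sqexp ^^ n) z \<in> S \<Longrightarrow> z \<in> S"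
  shows "frontier G \<inter> S \<noteq> {}"
  using frontier_sqexp_iterate_image[OF assms(1,2), of n] assms(3,4) by blast

text \<open>Radius 9 is what \<open>frontier_meets_bungee_set\<close> requires; the disc also
  contains \<open>1 > ln 2\<close>, from where the escaping ray can be followed.\<close>

lemma iterates_cover_disc:
  assumes "open G" "G - bounded_orbit_set sqexp \<noteq> {}"
  obtains n where "ball 0 9 \<subseteq> (sqexp ^^ n) ` G"
proof -
  obtain z where z: "z \<in> G" "z \<notin> bounded_orbit_set sqexp" using assms(2) by blast
  obtain r where r: "r > 0" "ball z r \<subseteq> G" using assms(1) z(1) openE by blast
  obtain n w x where w: "w \<in> ball z r" "(sqexp ^^ n) w = of_real x" "ln 2 \<le> x"
    by (rule iterates_meet_ray[of "ball z r" z]) (use r z in auto)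
  then have "of_real x \<in> (sqexp ^^ n) ` G" using r by (metis image_eqI subsetD)
  then obtain m where "ball 0 9 \<subseteq> (sqexp ^^ m) ` (sqexp ^^ n) ` G"
    using ray_blowup[OF open_sqexp_iterate_image[OF assms(1)] _ w(3)] by blast
  then show ?thesis using that[of "m + n"] by (simp add: image_comp funpow_add)
qed

text \<open>A connected unbounded set that meets the bounded set \<open>G\<close> must leave it, and
  it crosses the frontier on the way.\<close>

lemma frontier_meets_ray:
  fixes I :: "real set" and G :: "complex set"
  assumes G: "bounded G" "of_real x \<in> G" "x \<in> I" and I: "connected I" "\<not> bounded I"
  obtains y where "y \<in> I" "of_real y \<in> frontier G"
proof -
  have "connected (complex_of_real ` I)"
    using I by (intro connected_continuous_image continuous_intros)
  moreover have "\<not> bounded (complex_of_real ` I)"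
    using I(2) by (simp add: bounded_iff)
  then have "complex_of_real ` I - G \<noteq> {}" using G(1) bounded_subset by blast
  moreover have "complex_of_real ` I \<inter> G \<noteq> {}" using G by blast
  ultimately have "complex_of_real ` I \<inter> frontier G \<noteq> {}" using connected_Int_frontier by blast
  then show ?thesis using that by blast
qed

theorem theorem1p1:
  shows "\<exists>f. transcendental_entire f \<and>
     connected_with_infinity (escaping_set f) \<and>
     connected_with_infinity (bounded_orbit_set f) \<and>
     connected_with_infinity (bungee_set f)"
proof (intro exI[of _ sqexp] conjI)
  show "transcendental_entire sqexp" by (rule sqexp_transcendental)
  have ub: "\<not> bounded {ln (2::real)<..}" "\<not> bounded {..<ln (2::real)}"
  proof -
    have "\<exists>x>ln 2. \<not> \<bar>x\<bar> \<le> a" "\<exists>x<ln 2. \<not> \<bar>x\<bar> \<le> a" for a :: real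
      by (rule exI[of _ "ln 2 + \<bar>a\<bar> + 1"], use ln_gt_zero[of "2::real"] in linarith)
        (rule exI[of _ "- \<bar>a\<bar> - 1"], use ln_gt_zero[of "2::real"] in linarith)
    then show "\<not> bounded {ln (2::real)<..}" "\<not> bounded {..<ln (2::real)}"
      unfolding bounded_iff real_norm_def by (metis greaterThan_iff, metis lessThan_iff)
  qed
  show "connected_with_infinity (escaping_set sqexp)"
  proof (rule connected_with_infinityI)
    fix G assume G: "open G" "bounded G" "G \<inter> escaping_set sqexp \<noteq> {}" "frontier G \<inter> escaping_set sqexp = {}"
    then obtain n where n: "ball 0 9 \<subseteq> (sqexp ^^ n) ` G"
      using iterates_cover_disc[OF G(1)] escaping_set_Int_bounded_orbit_set[of sqexp] by blast
    have 1: "of_real 1 \<in> (sqexp ^^ n) ` G" using n by (auto simp: subset_iff)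
    obtain y where "y \<in> {ln 2<..}" "of_real y \<in> frontier ((sqexp ^^ n) ` G)"
      by (rule frontier_meets_ray[OF bounded_sqexp_iterate_image[OF G(2)] 1])
        (use ub ln_2_less_1 in auto)
    then show False using frontier_iterate_pullback[OF G(1,2), of n "escaping_set sqexp"] G(4)
      real_above_escaping escaping_set_iterate by blast
  qed
  show "connected_with_infinity (bungee_set sqexp)"
  proof (rule connected_with_infinityI)
    fix G assume G: "open G" "bounded G" "G \<inter> bungee_set sqexp \<noteq> {}" "frontier G \<inter> bungee_set sqexp = {}"
    then obtain n where n: "ball 0 9 \<subseteq> (sqexp ^^ n) ` G"
      using iterates_cover_disc[OF G(1)] unfolding bungee_set_def by blast
    have "frontier ((sqexp ^^ n) ` G) \<inter> bungee_set sqexp \<noteq> {}"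
      using G n by (intro frontier_meets_bungee_set open_sqexp_iterate_image bounded_sqexp_iterate_image)
    then show False using frontier_iterate_pullback[OF G(1,2)] G(4) bungee_set_iterate by blast
  qed
  show "connected_with_infinity (bounded_orbit_set sqexp)"
  proof (rule connected_with_infinityI)
    fix G assume G: "open G" "bounded G" "G \<inter> bounded_orbit_set sqexp \<noteq> {}" "frontier G \<inter> bounded_orbit_set sqexp = {}"
    obtain n z where "z \<in> G" "(sqexp ^^ n) z \<in> \<real>"
      using iterates_meet_real_line[OF G(1)] G(3) by blast
    then obtain x where x: "of_real x \<in> (sqexp ^^ n) ` G" by (metis Reals_cases image_eqI)
    \<comment> \<open>A real point at or beyond \<open>ln 2\<close> is traded for \<open>0\<close>,
      which a blown-up image contains.\<close>
    have "\<exists>n x. of_real x \<in> (sqexp ^^ n) ` G \<and> x < ln 2"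
    proof (cases "x < ln 2")
      case False
      then obtain m where "ball 0 1 \<subseteq> (sqexp ^^ m) ` (sqexp ^^ n) ` G"
        using ray_blowup[OF open_sqexp_iterate_image[OF G(1)] x] by (metis not_less)
      then have "of_real 0 \<in> (sqexp ^^ (m + n)) ` G" by (auto simp: image_comp funpow_add subset_iff)
      then show ?thesis by (intro exI[of _ "m + n"] exI[of _ 0]) simp
    qed (use x in blast)
    then obtain n x where x: "of_real x \<in> (sqexp ^^ n) ` G" "x < ln 2" by blast
    obtain y where "y \<in> {..<ln 2}" "of_real y \<in> frontier ((sqexp ^^ n) ` G)"
      by (rule frontier_meets_ray[OF bounded_sqexp_iterate_image[OF G(2)] x(1), of "{..<ln 2}"])
        (use ub x(2) in auto)
    then show False using frontier_iterate_pullback[OF G(1,2), of n "bounded_orbit_set sqexp"] G(4)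
      real_below_bounded_orbit bounded_orbit_set_iterate by blast
  qed
qed

end
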